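(* Let $n\ge3$ be an integer, and let $a_{p,i}$ be integers for $p$ prime and $1\le i\le n-2$, with $a_{p,1}\ne0$ for every prime $p$. Then the number of isomorphism classes of filtered $\lambda$-ring structures $R$ on $\mathbf{Z}[x]/(x^n)$ satisfying \[\psi^p_R(x)\equiv a_{p,1}x+\cdots+a_{p,n-2}x^{n-2}\pmod{x^{n-1}}\] for all primes $p$ is at most $\min\{|a_{p,1}^{n-1}-a_{p,1}|\colon p\text{ prime}\}$.
   Context: A (special) $\lambda$-ring is a commutative ring with operations $\lambda^i$ satisfying the Atiyah–Tall axioms; a filtered $\lambda$-ring is a $\lambda$-ring with decreasing filtration by ideals closed under $\lambda^i$, $i\ge1$; isomorphisms are filtration-preserving $\lambda$-ring isomorphisms. $\mathbf{Z}[x]/(x^n)$ is filtered with $x$ in filtration exactly $d$ for some fixed $d\ge1$, i.e. $I^k$ is generated by the $x^j$ with $jd\ge k$. A filtered $\lambda$-ring structure $R$ on it is determined by the polynomials $\psi^p_R(x)$ (the Adams operations applied to $x$) for primes $p$. *)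

theory Defs
  imports "HOL-Library.Poly_Mapping" "HOL-Computational_Algebra.Polynomial"
          "HOL-Computational_Algebra.Primes"
begin

type_synonym int_mpoly = "(nat \<Rightarrow>\<^sub>0 nat) \<Rightarrow>\<^sub>0 int"

definition mp_vars :: "int_mpoly \<Rightarrow> nat set" where
  "mp_vars P = \<Union> (Poly_Mapping.keys ` Poly_Mapping.keys P)"

definition mpeval :: "int_mpoly \<Rightarrow> (nat \<Rightarrow> 'a::comm_ring_1) \<Rightarrow> 'a" where
  "mpeval P f = (\<Sum>m\<in>Poly_Mapping.keys P. of_int (Poly_Mapping.lookup P m) * (\<Prod>v\<in>Poly_Mapping.keys m. f v ^ Poly_Mapping.lookup m v))"

definition esym :: "'b set \<Rightarrow> nat \<Rightarrow> ('b \<Rightarrow> 'a::comm_ring_1) \<Rightarrow> 'a" where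
  "esym I k f = (\<Sum>T\<in>{T. T \<subseteq> I \<and> card T = k}. \<Prod>a\<in>T. f a)"

text \<open>Universal polynomial P_k(s_1..s_k; t_1..t_k) of the lambda-ring axioms;
  s_i is the variable 2i, t_i the variable 2i+1. It is characterised by
  P_k(e_1(x),..,e_k(x); e_1(y),..,e_k(y)) = coefficient of T^k in prod_(a,b)(1 + x_a y_b T),
  with k variables x and k variables y (an identity of integer polynomials, equivalently
  an identity at all integer points).\<close>
definition lamP :: "nat \<Rightarrow> int_mpoly" where
  "lamP k = (THE P. mp_vars P \<subseteq> {v. 1 \<le> v div 2 \<and> v div 2 \<le> k} \<and>
     (\<forall>x y :: nat \<Rightarrow> int.
        mpeval P (\<lambda>v. if even v then esym {1..k} (v div 2) x else esym {1..k} (v div 2) y)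
        = esym ({1..k} \<times> {1..k}) k (\<lambda>(a, b). x a * y b)))"

text \<open>Universal polynomial P_{i,j}(s_1,..,s_{ij}) (variable v is s_v), characterised by
  P_{i,j}(e_1(x),..,e_{ij}(x)) = coefficient of T^i in prod_{|S|=j} (1 + x_S T).\<close>
definition lamPP :: "nat \<Rightarrow> nat \<Rightarrow> int_mpoly" where
  "lamPP i j = (THE P. mp_vars P \<subseteq> {1..i*j} \<and>
     (\<forall>x :: nat \<Rightarrow> int.
        mpeval P (\<lambda>v. esym {1..i*j} v x)
        = esym {S. S \<subseteq> {1..i*j} \<and> card S = j} i (\<lambda>S. \<Prod>a\<in>S. x a)))"

section \<open>The ring Z[x]/(x^n), represented by integer polynomials of degree < n\<close>

definition trunc :: "nat \<Rightarrow> int poly \<Rightarrow> int poly" where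
  "trunc n p = (\<Sum>j<n. monom (coeff p j) j)"

definition trunc_carrier :: "nat \<Rightarrow> int poly set" where
  "trunc_carrier n = {p. \<forall>j\<ge>n. coeff p j = 0}"

definition tmul :: "nat \<Rightarrow> int poly \<Rightarrow> int poly \<Rightarrow> int poly" where
  "tmul n p q = trunc n (p * q)"

text \<open>Filtration: x in filtration exactly d; I^k spanned by the x^j with j*d \<ge> k.\<close>
definition filt :: "nat \<Rightarrow> nat \<Rightarrow> nat \<Rightarrow> int poly set" where
  "filt n d k = {p \<in> trunc_carrier n. \<forall>j. coeff p j \<noteq> 0 \<longrightarrow> k \<le> j * d}"

text \<open>Special lambda-ring structure (Atiyah--Tall axioms) on Z[x]/(x^n) given by
  operations lam i (values outside the carrier are irrelevant).\<close>
definition is_lambda_ring :: "nat \<Rightarrow> (nat \<Rightarrow> int poly \<Rightarrow> int poly) \<Rightarrow> bool" where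
  "is_lambda_ring n lam \<longleftrightarrow>
     (\<forall>i. \<forall>a\<in>trunc_carrier n. lam i a \<in> trunc_carrier n) \<and>
     (\<forall>a\<in>trunc_carrier n. lam 0 a = 1) \<and>
     (\<forall>a\<in>trunc_carrier n. lam 1 a = a) \<and>
     (\<forall>k. \<forall>a\<in>trunc_carrier n. \<forall>b\<in>trunc_carrier n.
         lam k (a + b) = trunc n (\<Sum>i\<le>k. lam i a * lam (k - i) b)) \<and>
     (\<forall>k\<ge>2. lam k 1 = 0) \<and>
     (\<forall>k\<ge>1. \<forall>a\<in>trunc_carrier n. \<forall>b\<in>trunc_carrier n.
         lam k (tmul n a b) =
           trunc n (mpeval (lamP k) (\<lambda>v. if even v then lam (v div 2) a else lam (v div 2) b))) \<and>
     (\<forall>i\<ge>1. \<forall>j\<ge>1. \<forall>a\<in>trunc_carrier n.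
         lam i (lam j a) = trunc n (mpeval (lamPP i j) (\<lambda>v. lam v a)))"

definition is_filtered_lambda_ring :: "nat \<Rightarrow> nat \<Rightarrow> (nat \<Rightarrow> int poly \<Rightarrow> int poly) \<Rightarrow> bool" where
  "is_filtered_lambda_ring n d lam \<longleftrightarrow> is_lambda_ring n lam \<and>
     (\<forall>i\<ge>1. \<forall>k. \<forall>a\<in>filt n d k. lam i a \<in> filt n d k)"

text \<open>Adams operations via the Newton formula
  psi^k = lam^1 psi^(k-1) - lam^2 psi^(k-2) + ... + (-1)^k lam^(k-1) psi^1 + (-1)^(k+1) k lam^k.\<close>
function adams :: "nat \<Rightarrow> (nat \<Rightarrow> int poly \<Rightarrow> int poly) \<Rightarrow> nat \<Rightarrow> int poly \<Rightarrow> int poly" where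
  "adams n lam k a =
     trunc n ((\<Sum>i\<in>{1..<k}. smult ((-1) ^ (i + 1)) (lam i a * adams n lam (k - i) a))
              + smult ((-1) ^ (k + 1) * int k) (lam k a))"
  by auto
termination by (relation "measure (\<lambda>(n, lam, k, a). k)") auto

definition filt_lambda_iso :: "nat \<Rightarrow> nat \<Rightarrow> (nat \<Rightarrow> int poly \<Rightarrow> int poly)
    \<Rightarrow> (nat \<Rightarrow> int poly \<Rightarrow> int poly) \<Rightarrow> bool" where
  "filt_lambda_iso n d lam lam' \<longleftrightarrow>
     (\<exists>\<phi>. bij_betw \<phi> (trunc_carrier n) (trunc_carrier n) \<and>
        (\<forall>a\<in>trunc_carrier n. \<forall>b\<in>trunc_carrier n. \<phi> (a + b) = \<phi> a + \<phi> b) \<and>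
        (\<forall>a\<in>trunc_carrier n. \<forall>b\<in>trunc_carrier n. \<phi> (tmul n a b) = tmul n (\<phi> a) (\<phi> b)) \<and>
        \<phi> 1 = 1 \<and>
        (\<forall>i. \<forall>a\<in>trunc_carrier n. \<phi> (lam i a) = lam' i (\<phi> a)) \<and>
        (\<forall>k. \<phi> ` filt n d k = filt n d k))"

end

(* Newton's formula makes every Adams operation psi^k an integral polynomial in the lambda
   operations. Since the universal polynomials exist (fundamental theorem on symmetric
   polynomials), the Newton identities show that the psi^k are ring endomorphisms with
   psi^k psi^l = psi^(kl), so on Z[x]/(x^n) each psi^p is the substitution of psi^p(x), and the
   psi^p determine the lambda operations, the ring being torsion-free.

   If two structures agree modulo x^(n-1) and psi^p(x) changes by beta_p x^(n-1), then
   psi^p psi^q = psi^q psi^p gives (a_q^(n-1) - a_q) beta_p = (a_p^(n-1) - a_p) beta_q.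
   The filtration forces p to divide a_p, so no a_p^(n-1) - a_p vanishes, and if this number
   divides beta_p for a single prime p, then one u satisfies
   beta_q = u (a_q^(n-1) - a_q) for all q; the automorphism x -> x - u x^(n-1) then carries
   one structure to the other. Hence the top coefficient of psi^p(x) modulo
   a_p^(n-1) - a_p determines the isomorphism class. *)
theory Submission
  imports Defs "HOL-Computational_Algebra.Fundamental_Theorem_Algebra"
    "HOL-Computational_Algebra.Formal_Power_Series" "HOL-Combinatorics.Transposition"
begin

text \<open>\<open>lamP\<close> and \<open>lamPP\<close> are definite descriptions, so nothing is
  known about them before existence and uniqueness are proved. Their identities are given at integer
  points, and elementary symmetric functions of integers do not attain all integer tuples;
  uniqueness therefore passes through the complex numbers, where every tuple is attained. The
  identities also fix the number of variables (\<open>k\<close> and \<open>k\<close>, or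
  \<open>i*j\<close>), whereas Newton's recursion at index \<open>k\<close> involves all smaller
  indices at once, so independence of the number of variables has to be proved together with the
  power sum formulas. Recovering elementary symmetric functions from power sums divides by
  factorials; the identities involved carry a factor \<open>fact j\<close>, which is cancelled
  afterwards. Computations take place in honest polynomial rings, where evaluation, exchange of
  variables and substitution are homomorphisms; reduction modulo x^n enters as a congruence.\<close>

definition is_hom :: "('a::comm_ring_1 \<Rightarrow> 'b::comm_ring_1) \<Rightarrow> bool" where
  "is_hom h \<longleftrightarrow> h 1 = 1 \<and> (\<forall>a b. h (a + b) = h a + h b) \<and> (\<forall>a b. h (a * b) = h a * h b)"

lemma hom_add: "is_hom h \<Longrightarrow> h (a + b) = h a + h b"
  and hom_mult: "is_hom h \<Longrightarrow> h (a * b) = h a * h b"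
  and hom_one: "is_hom h \<Longrightarrow> h 1 = 1"
  by (simp_all add: is_hom_def)

lemma hom_zero: "is_hom h \<Longrightarrow> h 0 = 0"
  using hom_add[of h 0 0] by simp

lemma hom_uminus: assumes "is_hom h" shows "h (- a) = - h a"
  using hom_add[OF assms, of a "- a"] hom_zero[OF assms] by (simp add: eq_neg_iff_add_eq_0 add.commute)

lemma hom_diff: "is_hom h \<Longrightarrow> h (a - b) = h a - h b"
  using hom_add[of h a "- b"] hom_uminus[of h b] by simp

lemma hom_sum: "is_hom h \<Longrightarrow> h (sum f A) = (\<Sum>a\<in>A. h (f a))"
  by (induction A rule: infinite_finite_induct) (auto simp: hom_zero hom_add)

lemma hom_prod: "is_hom h \<Longrightarrow> h (prod f A) = (\<Prod>a\<in>A. h (f a))"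
  by (induction A rule: infinite_finite_induct) (auto simp: hom_one hom_mult)

lemma hom_power: "is_hom h \<Longrightarrow> h (a ^ k) = h a ^ k"
  by (induction k) (auto simp: hom_one hom_mult)

lemma hom_of_nat: "is_hom h \<Longrightarrow> h (of_nat k) = of_nat k"
  by (induction k) (auto simp: hom_zero hom_one hom_add)

lemma hom_of_int: "is_hom h \<Longrightarrow> h (of_int k) = of_int k"
  by (cases k) (auto simp: hom_of_nat hom_uminus hom_diff hom_one)

lemmas hom_simps = hom_add hom_mult hom_one hom_zero hom_uminus hom_diff hom_sum hom_prod
  hom_power hom_of_nat hom_of_int

lemma hom_esym: "is_hom h \<Longrightarrow> h (esym I k f) = esym I k (\<lambda>a. h (f a))"
  by (simp add: esym_def hom_simps)

lemma hom_mpeval: "is_hom h \<Longrightarrow> h (mpeval P f) = mpeval P (\<lambda>v. h (f v))"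
  by (simp add: mpeval_def hom_simps)

section \<open>Evaluation of integer polynomials in countably many variables\<close>

definition mon :: "(nat \<Rightarrow>\<^sub>0 nat) \<Rightarrow> (nat \<Rightarrow> 'a::comm_ring_1) \<Rightarrow> 'a" where
  "mon m f = (\<Prod>v\<in>Poly_Mapping.keys m. f v ^ Poly_Mapping.lookup m v)"

lemma mon_superset:
  assumes "finite V" "Poly_Mapping.keys m \<subseteq> V"
  shows "mon m f = (\<Prod>v\<in>V. f v ^ Poly_Mapping.lookup m v)"
  unfolding mon_def using assms
  by (intro prod.mono_neutral_left) (auto simp: in_keys_iff)

lemma mon_add: "mon (m + m') f = mon m f * mon m' f"
proof -
  let ?V = "Poly_Mapping.keys m \<union> Poly_Mapping.keys m'"
  have "Poly_Mapping.keys (m + m') \<subseteq> ?V" by (rule keys_add)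
  then show ?thesis
    by (simp add: mon_superset[of ?V] lookup_add power_add prod.distrib)
qed

lemma mon_zero [simp]: "mon 0 f = 1"
  by (simp add: mon_def)

text \<open>Supports can shrink by cancellation, so additivity is proved by summing over a common
  finite superset.\<close>

lemma mpeval_superset:
  assumes "finite K" "Poly_Mapping.keys P \<subseteq> K"
  shows "mpeval P f = (\<Sum>m\<in>K. of_int (Poly_Mapping.lookup P m) * mon m f)"
  unfolding mpeval_def mon_def using assms
  by (intro sum.mono_neutral_left) (auto simp: in_keys_iff)

lemma mpeval_add: "mpeval (P + Q) f = mpeval P f + mpeval Q f"
proof -
  let ?K = "Poly_Mapping.keys P \<union> Poly_Mapping.keys Q"
  have "Poly_Mapping.keys (P + Q) \<subseteq> ?K" by (rule keys_add)
  then show ?thesis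
    by (simp add: mpeval_superset[of ?K] lookup_add distrib_right sum.distrib)
qed

lemma mpeval_single: "mpeval (Poly_Mapping.single m c) f = of_int c * mon m f"
  by (simp add: mpeval_superset[of "{m}"])

text \<open>Induction on single terms proves multiplicativity of evaluation without unfolding the
  convolution product.\<close>

lemma int_mpoly_induct [case_names single add]:
  fixes P :: int_mpoly
  assumes "\<And>m c. R (Poly_Mapping.single m c)" "\<And>P Q. R P \<Longrightarrow> R Q \<Longrightarrow> R (P + Q)"
  shows "R P"
proof -
  have eq: "P = (\<Sum>m\<in>Poly_Mapping.keys P. Poly_Mapping.single m (Poly_Mapping.lookup P m))"
    by (rule poly_mapping_eqI)
      (auto simp: lookup_sum lookup_single when_def in_keys_iff sum.delta' split: if_splits)
  \<comment> \<open>The empty sum is covered because \<open>single 0 0\<close> is the zero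
    polynomial.\<close>
  have "R (\<Sum>m\<in>K. Poly_Mapping.single m (c m))" if "finite K" for K and c :: "_ \<Rightarrow> int"
    using that by (induction K) (use assms(1)[of 0 0] in \<open>auto intro: assms\<close>)
  then show ?thesis by (subst eq) simp
qed

lemma mpeval_mult: "mpeval (P * Q) f = mpeval P f * mpeval Q f"
proof (induction P rule: int_mpoly_induct)
  case (single m c)
  show ?case
    by (induction Q rule: int_mpoly_induct)
      (simp_all add: mult_single mpeval_single mon_add mpeval_add algebra_simps)
qed (simp add: mpeval_add distrib_right)

lemma is_hom_mpeval: "is_hom (\<lambda>P. mpeval P f)"
proof -
  have "mpeval 1 f = 1"
    using mpeval_single[of 0 1 f] by simp
  then show ?thesis by (simp add: is_hom_def mpeval_add mpeval_mult)
qed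

lemmas mpeval_simps = hom_simps[OF is_hom_mpeval]

definition Var :: "nat \<Rightarrow> int_mpoly" where
  "Var v = Poly_Mapping.single (Poly_Mapping.single v 1) 1"

lemma mpeval_Var [simp]: "mpeval (Var v) f = f v"
  by (simp add: Var_def mpeval_single mon_def)

lemma inj_Var: "inj Var"
proof (rule injI)
  fix v w assume "Var v = Var w"
  then have "mpeval (Var v) (\<lambda>u. if u = v then 1 else 0 :: int) = mpeval (Var w) (\<lambda>u. if u = v then 1 else 0)"
    by simp
  then show "v = w" by (simp split: if_splits)
qed

lemma mpeval_cong:
  assumes "\<And>v. v \<in> mp_vars P \<Longrightarrow> f v = g v"
  shows "mpeval P f = mpeval P g"
  unfolding mpeval_def
  by (intro sum.cong refl arg_cong2[where f = times] prod.cong arg_cong2[where f = power] assms)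
    (auto simp: mp_vars_def)

lemma mp_vars_Var: "mp_vars (Var v) \<subseteq> {v}"
  by (auto simp: mp_vars_def Var_def split: if_splits)

lemma mp_vars_add: "mp_vars (P + Q) \<subseteq> mp_vars P \<union> mp_vars Q"
  using keys_add[of P Q] by (auto simp: mp_vars_def)

lemma mp_vars_diff: "mp_vars (P - Q) \<subseteq> mp_vars P \<union> mp_vars Q"
  using keys_diff[of P Q] by (auto simp: mp_vars_def)

lemma mp_vars_mult: "mp_vars (P * Q) \<subseteq> mp_vars P \<union> mp_vars Q"
proof
  fix v assume "v \<in> mp_vars (P * Q)"
  then obtain m where m: "m \<in> Poly_Mapping.keys (P * Q)" "v \<in> Poly_Mapping.keys m"
    by (auto simp: mp_vars_def)
  then obtain a b where "m = a + b" "a \<in> Poly_Mapping.keys P" "b \<in> Poly_Mapping.keys Q"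
    using keys_mult by blast
  with m(2) show "v \<in> mp_vars P \<union> mp_vars Q"
    using keys_add[of a b] by (auto simp: mp_vars_def)
qed

lemma mp_vars_of_int: "mp_vars (of_int c) = {}"
  by (auto simp: mp_vars_def in_keys_iff lookup_of_int when_def split: if_splits)

section \<open>Integer polynomials are determined by their values\<close>

lemma digits_inj:
  fixes B :: nat
  assumes "\<And>i. i < N \<Longrightarrow> f i < B" "\<And>i. i < N \<Longrightarrow> g i < B"
    and "(\<Sum>i<N. f i * B ^ i) = (\<Sum>i<N. g i * B ^ i)" and "i < N"
  shows "f i = g i"
  using assms
proof (induction N arbitrary: f g i)
  case (Suc N)
  let ?F = "\<Sum>i<N. f (Suc i) * B ^ i" and ?G = "\<Sum>i<N. g (Suc i) * B ^ i"
  have eq: "f 0 + B * ?F = g 0 + B * ?G"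
    using Suc.prems(3) unfolding sum.lessThan_Suc_shift by (simp add: sum_distrib_left mult_ac)
  have *: "f 0 < B" "g 0 < B" using Suc.prems by auto
  then have B: "B > 0" by auto
  have "(f 0 + B * ?F) mod B = f 0" "(g 0 + B * ?G) mod B = g 0" using * by simp_all
  with eq have 0: "f 0 = g 0" by simp
  with eq B have 1: "?F = ?G" by simp
  show ?case
  proof (cases i)
    case (Suc j)
    then show ?thesis
      using Suc.IH[of "\<lambda>i. f (Suc i)" "\<lambda>i. g (Suc i)" j] Suc.prems 1 by auto
  qed (use 0 in simp)
qed simp

(* Kronecker substitution x_v = t ^ (B ^ v) keeps distinct monomials distinct. *)
lemma mpeval_int_eq_0_imp:
  assumes "\<And>f :: nat \<Rightarrow> int. mpeval P f = 0"
  shows "P = 0"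
proof -
  let ?K = "Poly_Mapping.keys P"
  let ?V = "mp_vars P"
  have finV: "finite ?V" by (auto simp: mp_vars_def)
  obtain N where N: "\<And>v. v \<in> ?V \<Longrightarrow> v < N"
    using finite_nat_set_iff_bounded finV by auto
  define L where "L = (\<lambda>(m, v). Poly_Mapping.lookup m v) ` (?K \<times> {..<N})"
  have "finite L" by (simp add: L_def)
  then obtain B where LB: "\<forall>x\<in>L. x < B"
    unfolding finite_nat_set_iff_bounded by (rule exE)
  have B: "Poly_Mapping.lookup m v < B" if "m \<in> ?K" "v < N" for m v
    by (rule LB[rule_format]) (use that in \<open>force simp: L_def\<close>)
  define w where "w m = (\<Sum>v<N. Poly_Mapping.lookup m v * B ^ v)" for m
  have keysN: "Poly_Mapping.keys m \<subseteq> {..<N}" if "m \<in> ?K" for m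
    using that N by (auto simp: mp_vars_def)
  have inj: "inj_on w ?K"
  proof (rule inj_onI)
    fix m m' assume m: "m \<in> ?K" "m' \<in> ?K" "w m = w m'"
    show "m = m'"
    proof (rule poly_mapping_eqI)
      fix v
      show "Poly_Mapping.lookup m v = Poly_Mapping.lookup m' v"
      proof (cases "v < N")
        case True
        then show ?thesis
          using digits_inj[of N "Poly_Mapping.lookup m" B "Poly_Mapping.lookup m'" v] m B
          by (simp add: w_def)
      next
        case False
        then have "v \<notin> Poly_Mapping.keys m" "v \<notin> Poly_Mapping.keys m'"
          using keysN m by auto
        then show ?thesis by (simp add: in_keys_iff)
      qed
    qed
  qed
  define q where "q = (\<Sum>m\<in>?K. monom (Poly_Mapping.lookup P m) (w m))"
  have mon_w: "mon m (\<lambda>v. t ^ (B ^ v)) = t ^ w m" if "m \<in> ?K" for m and t :: int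
  proof -
    have "mon m (\<lambda>v. t ^ (B ^ v)) = (\<Prod>v<N. (t ^ (B ^ v)) ^ Poly_Mapping.lookup m v)"
      by (rule mon_superset) (use keysN that in auto)
    also have "\<dots> = t ^ w m"
      by (simp add: w_def power_sum mult.commute flip: power_mult)
    finally show ?thesis .
  qed
  have "poly q t = mpeval P (\<lambda>v. t ^ (B ^ v))" for t
    by (simp add: q_def poly_sum poly_monom mpeval_superset[of ?K] mon_w)
  then have "poly q t = 0" for t using assms by simp
  then have "q = 0" using poly_all_0_iff_0[of q] by blast
  have "Poly_Mapping.lookup P m = 0" if "m \<in> ?K" for m
  proof -
    have "0 = coeff q (w m)" by (simp add: \<open>q = 0\<close>)
    also have "\<dots> = (\<Sum>m'\<in>?K. if m' = m then Poly_Mapping.lookup P m' else 0)"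
      unfolding q_def coeff_sum coeff_monom
      by (intro sum.cong refl) (use inj that in \<open>auto dest: inj_onD\<close>)
    also have "\<dots> = Poly_Mapping.lookup P m" using that by simp
    finally show ?thesis by simp
  qed
  then show ?thesis by (intro poly_mapping_eqI) (auto simp: in_keys_iff)
qed

section \<open>Elementary symmetric functions\<close>

lemma esym_0 [simp]: "finite I \<Longrightarrow> esym I 0 f = 1"
proof -
  assume "finite I"
  then have "{T. T \<subseteq> I \<and> card T = 0} = {{}}" by (auto dest: finite_subset)
  then show ?thesis by (simp add: esym_def)
qed

lemma esym_eq_0: "finite I \<Longrightarrow> card I < k \<Longrightarrow> esym I k f = 0"
proof -
  assume *: "finite I" "card I < k"
  have "card T \<le> card I" if "T \<subseteq> I" for T using *(1) that by (rule card_mono)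
  then have "\<not> (T \<subseteq> I \<and> card T = k)" for T using *(2) by (metis linorder_not_less)
  then have "{T. T \<subseteq> I \<and> card T = k} = {}" by simp
  then show "esym I k f = 0" by (simp only: esym_def sum.empty)
qed

lemma esym_cong: "(\<And>a. a \<in> I \<Longrightarrow> f a = g a) \<Longrightarrow> esym I k f = esym I k g"
  unfolding esym_def by (intro sum.cong prod.cong) auto

lemma esym_insert:
  assumes "finite I" "a \<notin> I"
  shows "esym (insert a I) (Suc k) f = esym I (Suc k) f + f a * esym I k f"
proof -
  let ?A = "{T. T \<subseteq> I \<and> card T = Suc k}" and ?B = "{T. T \<subseteq> I \<and> card T = k}"
  have fin: "finite ?A" "finite ?B" using assms by auto
  have eq: "{T. T \<subseteq> insert a I \<and> card T = Suc k} = ?A \<union> insert a ` ?B"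
  proof (intro set_eqI iffI)
    fix T assume T: "T \<in> {T. T \<subseteq> insert a I \<and> card T = Suc k}"
    then have "finite T" using assms by (auto dest: finite_subset)
    show "T \<in> ?A \<union> insert a ` ?B"
    proof (cases "a \<in> T")
      case True
      then have "T = insert a (T - {a})" "T - {a} \<in> ?B"
        using T \<open>finite T\<close> by (auto simp: card_Diff_singleton)
      then show ?thesis by blast
    qed (use T in auto)
  next
    fix T assume "T \<in> ?A \<union> insert a ` ?B"
    then show "T \<in> {T. T \<subseteq> insert a I \<and> card T = Suc k}"
    proof
      assume "T \<in> insert a ` ?B"
      then obtain U where U: "T = insert a U" "U \<subseteq> I" "card U = k" by auto
      moreover have "finite U" "a \<notin> U" using U assms by (auto dest: finite_subset)
      ultimately show ?thesis by auto
    qed auto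
  qed
  have inj: "inj_on (insert a) ?B" using assms by (auto simp: inj_on_def)
  have disj: "?A \<inter> insert a ` ?B = {}" using assms by auto
  have "esym (insert a I) (Suc k) f = (\<Sum>T\<in>?A. \<Prod>b\<in>T. f b) + (\<Sum>T\<in>?B. \<Prod>b\<in>insert a T. f b)"
    unfolding esym_def eq using fin disj inj by (simp add: sum.union_disjoint sum.reindex)
  also have "(\<Sum>T\<in>?B. \<Prod>b\<in>insert a T. f b) = (\<Sum>T\<in>?B. f a * (\<Prod>b\<in>T. f b))"
    using assms by (intro sum.cong refl prod.insert) (auto dest: finite_subset)
  finally show ?thesis by (simp add: esym_def sum_distrib_left)
qed

lemma esym_empty_Suc [simp]: "esym {} (Suc k) f = 0"
  by (simp add: esym_eq_0)

lemma esym_reindex: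
  assumes "bij_betw \<pi> A A'"
  shows "esym A k (\<lambda>a. f (\<pi> a)) = esym A' k f"
proof -
  have inj: "inj_on \<pi> A" and img: "\<pi> ` A = A'" using assms by (auto simp: bij_betw_def)
  have "bij_betw (image \<pi>) {T. T \<subseteq> A \<and> card T = k} {T. T \<subseteq> A' \<and> card T = k}"
  proof -
    have "inj_on (image \<pi>) {T. T \<subseteq> A \<and> card T = k}"
      by (rule inj_onI) (use inj in \<open>simp add: inj_on_image_eq_iff\<close>)
    moreover have "image \<pi> ` {T. T \<subseteq> A \<and> card T = k} = {T. T \<subseteq> A' \<and> card T = k}"
    proof (intro set_eqI iffI)
      fix U assume "U \<in> image \<pi> ` {T. T \<subseteq> A \<and> card T = k}"
      then show "U \<in> {T. T \<subseteq> A' \<and> card T = k}"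
        using inj img by (auto intro!: card_image intro: inj_on_subset)
    next
      fix U assume U: "U \<in> {T. T \<subseteq> A' \<and> card T = k}"
      then obtain T where T: "T \<subseteq> A" "U = \<pi> ` T"
        using img by (metis mem_Collect_eq subset_imageE)
      then have "card T = k" using U inj by (metis (mono_tags, lifting) card_image inj_on_subset mem_Collect_eq)
      then show "U \<in> image \<pi> ` {T. T \<subseteq> A \<and> card T = k}" using T by auto
    qed
    ultimately show ?thesis by (simp add: bij_betw_def)
  qed
  from sum.reindex_bij_betw[OF this, of "\<lambda>T. \<Prod>a\<in>T. f a"]
  have "esym A' k f = (\<Sum>T\<in>{T. T \<subseteq> A \<and> card T = k}. \<Prod>a\<in>\<pi> ` T. f a)"
    by (simp add: esym_def)
  also have "\<dots> = esym A k (\<lambda>a. f (\<pi> a))"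
    unfolding esym_def
    by (intro sum.cong refl prod.reindex_cong[of \<pi>]) (use inj in \<open>auto intro: inj_on_subset\<close>)
  finally show ?thesis ..
qed

text \<open>On generating functions, removing \<open>a\<close> is division by 1 + f(a) T; the sum is
  the geometric series of the inverse. It expresses the symmetric functions of fewer variables by
  those of all variables and the removed one.\<close>

lemma esym_remove:
  assumes "finite I" "a \<notin> I"
  shows "esym I k f = (\<Sum>j\<le>k. (- f a) ^ j * esym (insert a I) (k - j) f)"
proof (induction k)
  case (Suc k)
  have "esym I (Suc k) f = esym (insert a I) (Suc k) f + (- f a) * esym I k f"
    by (simp add: esym_insert[OF assms])
  also have "\<dots> = (\<Sum>j\<le>Suc k. (- f a) ^ j * esym (insert a I) (Suc k - j) f)"
    unfolding Suc.IH by (simp add: sum.atMost_Suc_shift sum_distrib_left mult_ac del: sum.atMost_Suc)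
  finally show ?case .
qed (use assms in simp)

lemma coeff_prod_linear:
  assumes "finite I"
  shows "coeff (\<Prod>a\<in>I. [:1, f a:]) k = esym I k f"
  using assms
proof (induction I arbitrary: k rule: finite_induct)
  case empty
  then show ?case by (cases k) simp_all
next
  case (insert a I)
  then show ?case by (cases k) (simp_all add: esym_insert)
qed

lemma factor_reversed_poly:
  fixes q :: "complex poly"
  assumes "coeff q 0 = 1" "degree q \<le> N"
  shows "\<exists>x :: nat \<Rightarrow> complex. q = (\<Prod>i\<in>{1..N}. [:1, x i:])"
  using assms
proof (induction N arbitrary: q)
  case 0
  then have "q = 1" by (metis degree_eq_zeroE coeff_pCons_0 le_zero_eq one_pCons)
  then show ?case by simp
next
  case (Suc N)
  have "\<exists>y s. q = [:1, y:] * s \<and> coeff s 0 = 1 \<and> degree s \<le> N"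
  proof (cases "degree q = 0")
    case True
    then have "q = [:1, 0:] * 1" using Suc.prems
      by (metis degree_eq_zeroE coeff_pCons_0 mult.right_neutral pCons_0_0)
    then show ?thesis by (intro exI[of _ 0] exI[of _ 1]) simp
  next
    case False
    then obtain r where r: "poly q r = 0"
      using alg_closed_imp_poly_has_root by blast
    have "r \<noteq> 0" using r Suc.prems(1) by (auto simp: poly_0_coeff_0)
    from r obtain s where s: "q = [:-r, 1:] * s"
      by (metis dvdE poly_eq_0_iff_dvd)
    have eq: "q = [:1, - 1 / r:] * smult (- r) s"
      unfolding s using \<open>r \<noteq> 0\<close> by (simp add: smult_add_right)
    have "q \<noteq> 0" using False by auto
    then have "degree q = Suc (degree s)"
      unfolding s by (subst degree_mult_eq) (auto simp: s)
    then show ?thesis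
      using Suc.prems \<open>r \<noteq> 0\<close> eq
      by (intro exI[of _ "- 1 / r"] exI[of _ "smult (- r) s"]) (auto simp: s)
  qed
  then obtain y s where s: "q = [:1, y:] * s" "coeff s 0 = 1" "degree s \<le> N" by blast
  from Suc.IH[OF s(2,3)] obtain x where x: "s = (\<Prod>i\<in>{1..N}. [:1, x i:])" by blast
  have "q = (\<Prod>i\<in>{1..Suc N}. [:1, (x(Suc N := y)) i:])"
    unfolding s(1) x by (simp add: mult.commute)
  then show ?case by blast
qed

text \<open>The prescribed values are the coefficients of a polynomial with constant term 1, and its
  factorisation supplies the point. This is what makes the elementary symmetric functions
  algebraically independent below.\<close>

lemma esym_complex_surj:
  fixes c :: "nat \<Rightarrow> complex"
  shows "\<exists>x. \<forall>i\<in>{1..N}. esym {1..N} i x = c i"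
proof -
  define q where "q = (1 :: complex poly) + (\<Sum>i\<in>{1..N}. monom (c i) i)"
  have co: "coeff q k = (if k = 0 then 1 else if k \<le> N then c k else 0)" for k
    by (auto simp: q_def coeff_sum coeff_monom coeff_1 when_def)
  have "degree q \<le> N" by (rule degree_le) (auto simp: co)
  then obtain x where "q = (\<Prod>i\<in>{1..N}. [:1, x i:])"
    using factor_reversed_poly[of q N] co[of 0] by auto
  then have "esym {1..N} i x = coeff q i" for i by (simp add: coeff_prod_linear)
  then show ?thesis by (intro exI[of _ x]) (auto simp: co)
qed

(* P composed with g vanishes at all integer points, hence is zero, hence vanishes at all complex
   points, where g is onto. *)
lemma mpoly_eq_0_via_surj:
  assumes surj: "\<And>c :: nat \<Rightarrow> complex. \<exists>x. \<forall>v\<in>V. mpeval (g v) x = c v"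
    and "mp_vars P \<subseteq> V"
    and van: "\<And>x :: nat \<Rightarrow> int. mpeval P (\<lambda>v. mpeval (g v) x) = 0"
  shows "P = 0"
proof (rule mpeval_int_eq_0_imp)
  fix f :: "nat \<Rightarrow> int"
  have "mpeval P g = 0"
    by (rule mpeval_int_eq_0_imp) (simp add: hom_mpeval[OF is_hom_mpeval] van)
  obtain x :: "nat \<Rightarrow> complex" where x: "\<forall>v\<in>V. mpeval (g v) x = of_int (f v)"
    using surj[of "\<lambda>v. of_int (f v)"] by blast
  have hom: "is_hom (of_int :: int \<Rightarrow> complex)" by (simp add: is_hom_def)
  have "of_int (mpeval P f) = mpeval P (\<lambda>v. of_int (f v) :: complex)"
    by (rule hom_mpeval[OF hom])
  also have "\<dots> = mpeval P (\<lambda>v. mpeval (g v) x)"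
    by (rule mpeval_cong) (use x assms(2) in auto)
  also have "\<dots> = mpeval (mpeval P g) x" by (simp add: hom_mpeval[OF is_hom_mpeval])
  also have "\<dots> = 0" by (simp add: \<open>mpeval P g = 0\<close> mpeval_simps)
  finally show "mpeval P f = 0" by simp
qed

section \<open>The fundamental theorem on symmetric polynomials\<close>

inductive_set alg :: "'a::comm_ring_1 set \<Rightarrow> 'a set" for G where
  alg_of_int: "of_int c \<in> alg G"
| alg_gen: "g \<in> G \<Longrightarrow> g \<in> alg G"
| alg_add: "a \<in> alg G \<Longrightarrow> b \<in> alg G \<Longrightarrow> a + b \<in> alg G"
| alg_mult: "a \<in> alg G \<Longrightarrow> b \<in> alg G \<Longrightarrow> a * b \<in> alg G"

lemma alg_trans: "f \<in> alg G \<Longrightarrow> G \<subseteq> alg H \<Longrightarrow> f \<in> alg H"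
  by (induction rule: alg.induct) (auto intro: alg.intros)

lemma alg_mono: "f \<in> alg G \<Longrightarrow> G \<subseteq> H \<Longrightarrow> f \<in> alg H"
  by (erule alg_trans) (auto intro: alg_gen)

lemma alg_0: "0 \<in> alg G" and alg_1: "1 \<in> alg G"
  using alg_of_int[of 0 G] alg_of_int[of 1 G] by simp_all

lemma alg_uminus: "a \<in> alg G \<Longrightarrow> - a \<in> alg G"
  using alg_mult[OF alg_of_int[of "-1" G], of a] by simp

lemma alg_sum: "(\<And>i. i \<in> A \<Longrightarrow> f i \<in> alg G) \<Longrightarrow> sum f A \<in> alg G"
  by (induction A rule: infinite_finite_induct) (auto intro: alg_0 alg_add)

lemma alg_prod: "(\<And>i. i \<in> A \<Longrightarrow> f i \<in> alg G) \<Longrightarrow> prod f A \<in> alg G"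
  by (induction A rule: infinite_finite_induct) (auto intro: alg_1 alg_mult)

lemma alg_power: "a \<in> alg G \<Longrightarrow> a ^ k \<in> alg G"
  by (induction k) (auto intro: alg_1 alg_mult)

lemma alg_esym: "(\<And>i. i \<in> I \<Longrightarrow> f i \<in> alg G) \<Longrightarrow> esym I k f \<in> alg G"
  unfolding esym_def by (intro alg_sum alg_prod) auto

lemma hom_fix_alg: "f \<in> alg G \<Longrightarrow> is_hom h \<Longrightarrow> (\<And>g. g \<in> G \<Longrightarrow> h g = g) \<Longrightarrow> h f = f"
  by (induction rule: alg.induct) (auto simp: hom_simps)

text \<open>Turns membership in a generated subring back into a polynomial, with the control of its
  variables that \<open>lamP\<close> and \<open>lamPP\<close> demand.\<close>

lemma alg_imp_mpoly:
  assumes "f \<in> alg (g ` V)"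
  shows "\<exists>P. mp_vars P \<subseteq> V \<and> mpeval P g = f"
  using assms
proof (induction rule: alg.induct)
  case (alg_of_int c)
  show ?case by (intro exI[of _ "of_int c"]) (simp add: mp_vars_of_int mpeval_simps)
next
  case (alg_gen a)
  then obtain v where "v \<in> V" "a = g v" by blast
  then show ?case using mp_vars_Var[of v] by (intro exI[of _ "Var v"]) auto
next
  case (alg_add a b)
  then obtain P Q where "mp_vars P \<subseteq> V" "mpeval P g = a" "mp_vars Q \<subseteq> V" "mpeval Q g = b" by blast
  then show ?case using mp_vars_add[of P Q] by (intro exI[of _ "P + Q"]) (auto simp: mpeval_simps)
next
  case (alg_mult a b)
  then obtain P Q where "mp_vars P \<subseteq> V" "mpeval P g = a" "mp_vars Q \<subseteq> V" "mpeval Q g = b" by blast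
  then show ?case using mp_vars_mult[of P Q] by (intro exI[of _ "P * Q"]) (auto simp: mpeval_simps)
qed

section \<open>Subrings generated by an element with a monic equation\<close>

definition reduced :: "'a::comm_ring_1 set \<Rightarrow> nat \<Rightarrow> 'a \<Rightarrow> 'a set" where
  "reduced C N X = {f. \<exists>c. (\<forall>j. c j \<in> alg C) \<and> f = (\<Sum>j<N. c j * X ^ j)}"

lemma reducedI: "(\<And>j. c j \<in> alg C) \<Longrightarrow> f = (\<Sum>j<N. c j * X ^ j) \<Longrightarrow> f \<in> reduced C N X"
  unfolding reduced_def by blast

lemma reduced_add:
  assumes "f \<in> reduced C N X" "g \<in> reduced C N X"
  shows "f + g \<in> reduced C N X"
proof -
  obtain c d where "\<And>j. c j \<in> alg C" "f = (\<Sum>j<N. c j * X ^ j)"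
      "\<And>j. d j \<in> alg C" "g = (\<Sum>j<N. d j * X ^ j)"
    using assms unfolding reduced_def by blast
  then show ?thesis
    by (intro reducedI[of "\<lambda>j. c j + d j"]) (auto simp: algebra_simps sum.distrib intro: alg_add)
qed

lemma reduced_scale:
  assumes "f \<in> reduced C N X" "a \<in> alg C"
  shows "a * f \<in> reduced C N X"
proof -
  obtain c where "\<And>j. c j \<in> alg C" "f = (\<Sum>j<N. c j * X ^ j)"
    using assms unfolding reduced_def by blast
  then show ?thesis using assms(2)
    by (intro reducedI[of "\<lambda>j. a * c j"]) (auto simp: sum_distrib_left mult_ac intro: alg_mult)
qed

lemma reduced_const: "N > 0 \<Longrightarrow> a \<in> alg C \<Longrightarrow> a \<in> reduced C N X"
  by (rule reducedI[of "\<lambda>j. if j = 0 then a else 0"])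
    (auto intro: alg_0 simp: if_distrib[of "\<lambda>x. x * _"] cong: if_cong)

lemma reduced_times_X:
  assumes f: "f \<in> reduced C N X" and XN: "X ^ N \<in> reduced C N X" and "N > 0"
  shows "X * f \<in> reduced C N X"
proof -
  obtain c where c: "\<And>j. c j \<in> alg C" "f = (\<Sum>j<N. c j * X ^ j)"
    using f unfolding reduced_def by blast
  obtain M where M: "N = Suc M" using \<open>N > 0\<close> by (cases N) auto
  \<comment> \<open>The shift pushes only the top term out of range; the relation for
    \<open>X ^ N\<close> brings it back.\<close>
  have "X * f = (\<Sum>j<N. (if j = 0 then 0 else c (j - 1)) * X ^ j) + c M * X ^ N"
    unfolding c(2) M by (subst (2) sum.lessThan_Suc_shift) (simp add: sum_distrib_left algebra_simps)
  moreover have "(\<Sum>j<N. (if j = 0 then 0 else c (j - 1)) * X ^ j) \<in> reduced C N X"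
    by (rule reducedI[of "\<lambda>j. if j = 0 then 0 else c (j - 1)"]) (auto intro: alg_0 c)
  ultimately show ?thesis by (simp add: reduced_add reduced_scale[OF XN c(1)])
qed

lemma reduced_mult:
  assumes f: "f \<in> reduced C N X" and g: "g \<in> reduced C N X"
    and XN: "X ^ N \<in> reduced C N X" and "N > 0"
  shows "f * g \<in> reduced C N X"
proof -
  obtain c where c: "\<And>j. c j \<in> alg C" "f = (\<Sum>j<N. c j * X ^ j)"
    using f unfolding reduced_def by blast
  have pow: "X ^ j * g \<in> reduced C N X" for j
    by (induction j) (use g reduced_times_X[OF _ XN \<open>N > 0\<close>] in \<open>auto simp: mult.assoc\<close>)
  have sum: "(\<Sum>j\<in>J. c j * (X ^ j * g)) \<in> reduced C N X" for J
    by (induction J rule: infinite_finite_induct)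
      (auto intro: reduced_add reduced_scale[OF pow c(1)] reduced_const[OF \<open>N > 0\<close> alg_0])
  show ?thesis using sum[of "{..<N}"] by (simp add: c(2) sum_distrib_right mult.assoc)
qed

text \<open>A monic equation of degree \<open>N\<close> for \<open>X\<close> over
  \<open>alg C\<close> makes the polynomials of degree below \<open>N\<close> in \<open>X\<close>
  closed under multiplication, so they exhaust the generated ring.\<close>

lemma alg_insert_reduced:
  assumes "f \<in> alg (insert X C)" and XN: "X ^ N \<in> reduced C N X" and "N > 0"
  shows "f \<in> reduced C N X"
  using assms(1)
proof (induction rule: alg.induct)
  case (alg_gen g)
  have "X * 1 \<in> reduced C N X"
    by (rule reduced_times_X) (use assms reduced_const[OF _ alg_1] in auto)
  then show ?case using alg_gen reduced_const[OF \<open>N > 0\<close> alg.alg_gen, of g C X] by auto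
qed (use assms in \<open>auto intro: reduced_const alg_of_int reduced_add reduced_mult\<close>)

text \<open>Only some homomorphism of the ambient ring has to realise the exchange on the family
  \<open>x\<close>. This lets the reduction be applied to one alphabet inside a polynomial ring that
  contains a second one.\<close>

definition swap_hom :: "('b \<Rightarrow> 'a::comm_ring_1) \<Rightarrow> 'b set \<Rightarrow> 'b \<Rightarrow> 'b \<Rightarrow> ('a \<Rightarrow> 'a) \<Rightarrow> bool" where
  "swap_hom x I i j h \<longleftrightarrow> is_hom h \<and> (\<forall>k\<in>I. h (x k) = x (transpose i j k))"

lemma swap_hom_esym:
  assumes "swap_hom x I i j h" "i \<in> I" "j \<in> I"
  shows "h (esym I k x) = esym I k x"
proof -
  have "h (esym I k x) = esym I k (\<lambda>a. x (transpose i j a))"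
    using assms by (auto simp: swap_hom_def hom_esym intro: esym_cong)
  also have "\<dots> = esym I k x"
    by (rule esym_reindex) (use assms(2,3) in \<open>simp add: bij_betw_transpose_iff\<close>)
  finally show ?thesis .
qed

(* By induction, f is a polynomial of degree < N in one variable x_a over the elementary symmetric
   functions of all N variables. Swapping x_a with the others, this polynomial takes the value f
   at N points, so it is constant. *)
lemma symmetric_reduction:
  fixes x :: "'b \<Rightarrow> 'a::idom"
  assumes "finite I" "inj_on x I" "f \<in> alg (G \<union> x ` I)"
    and "\<And>i j. i \<in> I \<Longrightarrow> j \<in> I \<Longrightarrow> i \<noteq> j \<Longrightarrow>
           \<exists>h. swap_hom x I i j h \<and> (\<forall>g\<in>G. h g = g) \<and> h f = f"
  shows "f \<in> alg (G \<union> range (\<lambda>k. esym I k x))"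
  using assms
proof (induction I arbitrary: G rule: finite_induct)
  case empty
  then show ?case by (auto intro: alg_mono)
next
  case (insert a I)
  let ?J = "insert a I"
  let ?C = "G \<union> range (\<lambda>k. esym ?J k x)"
  define N where "N = card ?J"
  have N: "N = Suc (card I)" using insert by (simp add: N_def)
  have esC: "esym ?J k x \<in> alg ?C" for k by (rule alg_gen) auto
  \<comment> \<open>For the induction hypothesis \<open>x a\<close> joins the fixed elements, since
    exchanges of the other indices do not move it.\<close>
  have "f \<in> alg (insert (x a) G \<union> range (\<lambda>k. esym I k x))"
  proof (rule insert.IH)
    fix i j assume ij: "i \<in> I" "j \<in> I" "i \<noteq> j"
    then obtain h where h: "swap_hom x ?J i j h" "\<forall>g\<in>G. h g = g" "h f = f"
      using insert.prems(3)[of i j] by blast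
    moreover have "transpose i j a = a" using ij insert.hyps by (auto simp: transpose_def)
    ultimately show "\<exists>h. swap_hom x I i j h \<and> (\<forall>g\<in>insert (x a) G. h g = g) \<and> h f = f"
      by (intro exI[of _ h]) (auto simp: swap_hom_def)
  qed (use insert.prems in \<open>auto simp: inj_on_def\<close>)
  then have fC: "f \<in> alg (insert (x a) ?C)"
  proof (rule alg_trans)
    have "esym I k x \<in> alg (insert (x a) ?C)" for k
      unfolding esym_remove[OF insert.hyps]
      by (intro alg_sum alg_mult alg_power alg_uminus) (auto intro: alg_gen)
    then show "insert (x a) G \<union> range (\<lambda>k. esym I k x) \<subseteq> alg (insert (x a) ?C)"
      by (auto intro: alg_gen)
  qed
  \<comment> \<open>Without \<open>a\<close> only \<open>N - 1\<close> variables remain, so their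
    \<open>N\<close>-th elementary symmetric function is 0; expanded by \<open>esym_remove\<close>,
    this is the monic equation of \<open>x a\<close>.\<close>
  have XN: "x a ^ N \<in> reduced ?C N (x a)"
  proof -
    have "0 = esym I N x" using insert.hyps by (simp add: esym_eq_0 N)
    also have "\<dots> = (\<Sum>j\<le>N. (- x a) ^ j * esym ?J (N - j) x)"
      by (rule esym_remove[OF insert.hyps])
    also have "\<dots> = (\<Sum>j<N. (- x a) ^ j * esym ?J (N - j) x) + (- x a) ^ N"
      using insert.hyps by (simp add: lessThan_Suc_atMost[symmetric])
    finally have eq: "(- x a) ^ N = (\<Sum>j<N. - ((- x a) ^ j * esym ?J (N - j) x))"
      by (simp add: sum_negf eq_neg_iff_add_eq_0 add.commute)
    have m: "(- x a) ^ j = (-1) ^ j * x a ^ j" for j by (rule power_minus)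
    have "x a ^ N = (-1) ^ N * (- x a) ^ N" by (simp flip: power_mult_distrib)
    also have "\<dots> = (\<Sum>j<N. ((-1) ^ N * (- ((-1) ^ j * esym ?J (N - j) x))) * x a ^ j)"
      unfolding eq sum_distrib_left by (intro sum.cong refl, subst m) (simp add: mult_ac)
    finally show ?thesis
      by (rule reducedI[rotated]) (intro alg_mult alg_uminus alg_power esC alg_1)
  qed
  obtain c where c: "\<And>j. c j \<in> alg ?C" "f = (\<Sum>j<N. c j * x a ^ j)"
    using alg_insert_reduced[OF fC XN] N unfolding reduced_def by auto
  have root: "f = (\<Sum>j<N. c j * x i ^ j)" if "i \<in> ?J" for i
  proof (cases "i = a")
    case False
    with that insert.prems(3)[of a i] obtain h where
      h: "swap_hom x ?J a i h" "\<forall>g\<in>G. h g = g" "h f = f" by blast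
    then have hom: "is_hom h" and hx: "h (x a) = x i" by (auto simp: swap_hom_def)
    have "h (c j) = c j" for j
      by (rule hom_fix_alg[OF c(1) hom])
        (use h(2) swap_hom_esym[OF h(1)] that in auto)
    then have "h (\<Sum>j<N. c j * x a ^ j) = (\<Sum>j<N. c j * x i ^ j)"
      by (simp add: hom_simps[OF hom] hx)
    then show ?thesis using h(3) c(2) by simp
  qed (use c in simp)
  define q where "q = (\<Sum>j<N. monom (c j) j) - [:f:]"
  have "degree q \<le> N - 1"
    unfolding q_def
    by (intro degree_diff_le degree_sum_le) (auto intro: order.trans[OF degree_monom_le])
  then have dq: "degree q < N" using N by simp
  have "q = 0"
  proof (rule ccontr)
    assume "q \<noteq> 0"
    have "x ` ?J \<subseteq> {t. poly q t = 0}"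
      by (auto simp: q_def poly_sum poly_monom simp flip: root)
    then have "card (x ` ?J) \<le> card {t. poly q t = 0}"
      by (intro card_mono poly_roots_finite \<open>q \<noteq> 0\<close>)
    also have "\<dots> \<le> degree q" by (rule card_poly_roots_bound[OF \<open>q \<noteq> 0\<close>])
    finally show False using dq insert.prems(1) by (simp only: card_image N_def)
  qed
  then have "0 = coeff q 0" by simp
  also have "\<dots> = c 0 - f"
    using N by (simp add: q_def coeff_sum)
  finally have "f = c 0" by simp
  then show ?case using c(1) by simp
qed

section \<open>The universal polynomials of the lambda-ring axioms\<close>

abbreviation VarX :: "nat \<Rightarrow> int_mpoly" where "VarX a \<equiv> Var (2 * a)"
abbreviation VarY :: "nat \<Rightarrow> int_mpoly" where "VarY a \<equiv> Var (2 * a + 1)"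

text \<open>The generic argument of \<open>lamP\<close>: the even and odd variables themselves play
  the roles of the x_a and y_b, so that one identity of polynomials replaces identities at all
  integer points.\<close>

definition elem2 :: "nat \<Rightarrow> nat \<Rightarrow> int_mpoly" where
  "elem2 k v = (if even v then esym {1..k} (v div 2) VarX else esym {1..k} (v div 2) VarY)"

definition elem1 :: "nat \<Rightarrow> nat \<Rightarrow> int_mpoly" where
  "elem1 k v = esym {1..k} v Var"

lemma elem2_eval:
  "mpeval (elem2 k v) z =
     (if even v then esym {1..k} (v div 2) (\<lambda>a. z (2 * a)) else esym {1..k} (v div 2) (\<lambda>a. z (2 * a + 1)))"
  by (simp add: elem2_def hom_esym[OF is_hom_mpeval])

lemma elem1_eval: "mpeval (elem1 k v) z = esym {1..k} v z"
  by (simp add: elem1_def hom_esym[OF is_hom_mpeval])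

lemma elem2_surj:
  fixes c :: "nat \<Rightarrow> complex"
  shows "\<exists>z. \<forall>v\<in>{v. 1 \<le> v div 2 \<and> v div 2 \<le> k}. mpeval (elem2 k v) z = c v"
proof -
  obtain x y where x: "\<forall>i\<in>{1..k}. esym {1..k} i x = c (2 * i)"
    and y: "\<forall>i\<in>{1..k}. esym {1..k} i y = c (2 * i + 1)"
    using esym_complex_surj[of k "\<lambda>i. c (2 * i)"] esym_complex_surj[of k "\<lambda>i. c (2 * i + 1)"] by blast
  show ?thesis
  proof (intro exI[of _ "\<lambda>v. if even v then x (v div 2) else y (v div 2)"] ballI)
    fix v assume "v \<in> {v. 1 \<le> v div 2 \<and> v div 2 \<le> k}"
    then show "mpeval (elem2 k v) (\<lambda>v. if even v then x (v div 2) else y (v div 2)) = c v"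
      using bspec[OF x, of "v div 2"] bspec[OF y, of "v div 2"]
      by (simp add: elem2_eval)
  qed
qed

lemma elem1_surj:
  fixes c :: "nat \<Rightarrow> complex"
  shows "\<exists>z. \<forall>v\<in>{1..k}. mpeval (elem1 k v) z = c v"
  using esym_complex_surj[of k c] by (simp add: elem1_eval)

definition swap_Var :: "nat \<Rightarrow> nat \<Rightarrow> int_mpoly \<Rightarrow> int_mpoly" where
  "swap_Var i j P = mpeval P (\<lambda>v. Var (transpose i j v))"

lemma is_hom_swap_Var: "is_hom (swap_Var i j)"
  unfolding swap_Var_def by (rule is_hom_mpeval)

lemma swap_Var_Var [simp]: "swap_Var i j (Var v) = Var (transpose i j v)"
  by (simp add: swap_Var_def)

lemma swap_hom_Var: "inj g \<Longrightarrow> swap_hom (\<lambda>a. Var (g a)) I i j (swap_Var (g i) (g j))"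
  by (auto simp: swap_hom_def is_hom_swap_Var transpose_def inj_eq)

text \<open>The right-hand side is symmetric in each alphabet separately, so the reduction is
  applied twice: to the x_a with the y_b held fixed, and to the y_b with the symmetric functions of
  the x_a held fixed.\<close>

lemma lamP_mpoly_ex:
  "\<exists>P. mp_vars P \<subseteq> {v. 1 \<le> v div 2 \<and> v div 2 \<le> k} \<and>
       mpeval P (elem2 k) = esym ({1..k} \<times> {1..k}) k (\<lambda>(a, b). VarX a * VarY b)"
    (is "\<exists>P. mp_vars P \<subseteq> ?V \<and> _ = ?f")
proof (rule alg_imp_mpoly)
  let ?I = "{1..k}"
  let ?EX = "range (\<lambda>i. esym ?I i VarX)" and ?EY = "range (\<lambda>i. esym ?I i VarY)"
  have f0: "?f \<in> alg (VarY ` ?I \<union> VarX ` ?I)"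
    by (rule alg_esym) (auto intro!: alg_mult intro: alg_gen)
  have swapX: "swap_Var (2 * i) (2 * j) ?f = ?f" if "i \<in> ?I" "j \<in> ?I" for i j
  proof -
    have "swap_Var (2 * i) (2 * j) ?f = esym (?I \<times> ?I) k (\<lambda>z. (\<lambda>(a, b). VarX a * VarY b) (map_prod (transpose i j) id z))"
      unfolding hom_esym[OF is_hom_swap_Var]
      by (intro esym_cong) (auto simp: hom_mult[OF is_hom_swap_Var] transpose_def, presburger+)
    also have "\<dots> = ?f"
      by (rule esym_reindex)
        (intro bij_betw_map_prod bij_betw_id, use that in \<open>simp add: bij_betw_transpose_iff\<close>)
    finally show ?thesis .
  qed
  have swapY: "swap_Var (2 * i + 1) (2 * j + 1) ?f = ?f" if "i \<in> ?I" "j \<in> ?I" for i j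
  proof -
    have "swap_Var (2 * i + 1) (2 * j + 1) ?f = esym (?I \<times> ?I) k (\<lambda>z. (\<lambda>(a, b). VarX a * VarY b) (map_prod id (transpose i j) z))"
      unfolding hom_esym[OF is_hom_swap_Var]
      by (intro esym_cong) (auto simp: hom_mult[OF is_hom_swap_Var] transpose_def, presburger+)
    also have "\<dots> = ?f"
      by (rule esym_reindex)
        (intro bij_betw_map_prod bij_betw_id, use that in \<open>simp add: bij_betw_transpose_iff\<close>)
    finally show ?thesis .
  qed
  have f1: "?f \<in> alg (VarY ` ?I \<union> ?EX)"
  proof (rule symmetric_reduction[OF _ _ f0])
    show "inj_on VarX ?I" by (auto simp: inj_on_def inj_eq[OF inj_Var])
    fix i j assume ij: "i \<in> ?I" "j \<in> ?I"
    have "swap_Var (2 * i) (2 * j) (VarY b) = VarY b" for b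
      by (subst swap_Var_Var, subst transpose_apply_other) presburger+
    then show "\<exists>h. swap_hom VarX ?I i j h \<and> (\<forall>g\<in>VarY ` ?I. h g = g) \<and> h ?f = ?f"
      using swap_hom_Var[of "\<lambda>a. 2 * a" ?I i j] swapX[OF ij]
      by (intro exI[of _ "swap_Var (2 * i) (2 * j)"]) (auto simp: inj_def)
  qed simp
  have f2: "?f \<in> alg (?EX \<union> ?EY)"
  proof (rule symmetric_reduction)
    show "?f \<in> alg (?EX \<union> VarY ` ?I)" using f1 by (simp add: Un_commute)
    show "inj_on VarY ?I" by (auto simp: inj_on_def inj_eq[OF inj_Var])
    fix i j assume ij: "i \<in> ?I" "j \<in> ?I"
    have "swap_Var (2 * i + 1) (2 * j + 1) (VarX b) = VarX b" for b
      by (subst swap_Var_Var, subst transpose_apply_other) presburger+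
    then have "swap_Var (2 * i + 1) (2 * j + 1) (esym ?I l VarX) = esym ?I l VarX" for l
      by (simp only: hom_esym[OF is_hom_swap_Var])
    then show "\<exists>h. swap_hom VarY ?I i j h \<and> (\<forall>g\<in>?EX. h g = g) \<and> h ?f = ?f"
      using swap_hom_Var[of "\<lambda>a. 2 * a + 1" ?I i j] swapY[OF ij]
      by (intro exI[of _ "swap_Var (2 * i + 1) (2 * j + 1)"]) (auto simp: inj_def)
  qed simp
  have gen: "esym ?I i VarX \<in> alg (elem2 k ` ?V)" "esym ?I i VarY \<in> alg (elem2 k ` ?V)" for i
  proof -
    consider "i = 0" | "i > k" | "i \<in> ?I" by force
    then show "esym ?I i VarX \<in> alg (elem2 k ` ?V)"
    proof cases
      case 3
      then have "elem2 k (2 * i) \<in> elem2 k ` ?V" by (intro imageI) auto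
      then show ?thesis by (auto simp: elem2_def intro: alg_gen)
    qed (auto simp: esym_eq_0 alg_0 alg_1)
    consider "i = 0" | "i > k" | "i \<in> ?I" by force
    then show "esym ?I i VarY \<in> alg (elem2 k ` ?V)"
    proof cases
      case 3
      then have "elem2 k (2 * i + 1) \<in> elem2 k ` ?V" by (intro imageI) auto
      then show ?thesis by (auto simp: elem2_def intro: alg_gen)
    qed (auto simp: esym_eq_0 alg_0 alg_1)
  qed
  show "?f \<in> alg (elem2 k ` ?V)"
    by (rule alg_trans[OF f2]) (use gen in auto)
qed

text \<open>The description of \<open>lamP\<close> is proper: the difference of two candidates
  vanishes at all elementary symmetric values of integers, hence is 0. The conclusion is an identity
  of polynomials, ready for evaluation in any commutative ring.\<close>

lemma
  shows lamP_vars: "mp_vars (lamP k) \<subseteq> {v. 1 \<le> v div 2 \<and> v div 2 \<le> k}"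
    and lamP_eval: "mpeval (lamP k) (elem2 k) = esym ({1..k} \<times> {1..k}) k (\<lambda>(a, b). VarX a * VarY b)"
proof -
  let ?V = "{v. 1 \<le> v div 2 \<and> v div 2 \<le> k}"
  let ?f = "esym ({1..k} \<times> {1..k}) k (\<lambda>(a, b). VarX a * VarY b)"
  let ?R = "\<lambda>P. mp_vars P \<subseteq> ?V \<and>
     (\<forall>x y :: nat \<Rightarrow> int.
        mpeval P (\<lambda>v. if even v then esym {1..k} (v div 2) x else esym {1..k} (v div 2) y)
        = esym ({1..k} \<times> {1..k}) k (\<lambda>(a, b). x a * y b))"
  obtain P where P: "mp_vars P \<subseteq> ?V" "mpeval P (elem2 k) = ?f" using lamP_mpoly_ex by blast
  have "mpeval P (\<lambda>v. if even v then esym {1..k} (v div 2) x else esym {1..k} (v div 2) y)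
        = esym ({1..k} \<times> {1..k}) k (\<lambda>(a, b). x a * y b)" for x y :: "nat \<Rightarrow> int"
  proof -
    let ?z = "\<lambda>v. if even v then x (v div 2) else y (v div 2)"
    have "mpeval P (\<lambda>v. mpeval (elem2 k v) ?z) = mpeval ?f ?z"
      by (simp only: P(2)[symmetric] hom_mpeval[OF is_hom_mpeval])
    then show ?thesis
      by (simp add: elem2_eval hom_esym[OF is_hom_mpeval] mpeval_simps case_prod_unfold cong: if_cong)
  qed
  then have RP: "?R P" using P(1) by blast
  have uniq: "Q = P" if "?R Q" for Q
  proof -
    have "Q - P = 0"
    proof (rule mpoly_eq_0_via_surj[of ?V "elem2 k"])
      show "mp_vars (Q - P) \<subseteq> ?V"
        using mp_vars_diff[of Q P] RP that by blast
      show "mpeval (Q - P) (\<lambda>v. mpeval (elem2 k v) x) = 0" for x :: "nat \<Rightarrow> int"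
        using RP that by (simp add: mpeval_simps elem2_eval)
    qed (rule elem2_surj)
    then show ?thesis by simp
  qed
  have "lamP k = P" unfolding lamP_def by (rule the_equality) (fact RP, fact uniq)
  then show "mp_vars (lamP k) \<subseteq> ?V" "mpeval (lamP k) (elem2 k) = ?f" using P by simp_all
qed

text \<open>Exchanging two variables permutes the \<open>j\<close>-element subsets and hence the
  products over them, so the right-hand side is symmetric.\<close>

lemma lamPP_mpoly_ex:
  "\<exists>P. mp_vars P \<subseteq> {1..i*j} \<and>
       mpeval P (elem1 (i*j)) = esym {S. S \<subseteq> {1..i*j} \<and> card S = j} i (\<lambda>S. \<Prod>a\<in>S. Var a)"
    (is "\<exists>P. _ \<and> _ = ?f")
proof (rule alg_imp_mpoly)
  let ?I = "{1..i*j}"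
  let ?\<S> = "{S. S \<subseteq> ?I \<and> card S = j}"
  have "?f \<in> alg ({} \<union> range (\<lambda>k. esym ?I k Var))"
  proof (rule symmetric_reduction)
    show "?f \<in> alg ({} \<union> Var ` ?I)"
      by (intro alg_esym alg_prod) (auto intro: alg_gen)
    show "inj_on Var ?I" using inj_Var by (auto simp: inj_on_def)
    fix u v assume uv: "u \<in> ?I" "v \<in> ?I"
    let ?t = "transpose u v"
    have inj: "inj_on ?t S" for S by (auto simp: inj_on_def transpose_eq_iff)
    have bij: "bij_betw (image ?t) ?\<S> ?\<S>"
    proof (rule bij_betw_byWitness[where f' = "image ?t"])
      have "?t ` S \<in> ?\<S>" if "S \<in> ?\<S>" for S
      proof -
        have "?t ` S \<subseteq> ?t ` ?I" using that by blast
        then show ?thesis using that uv by (simp add: card_image[OF inj])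
      qed
      then show "image ?t ` ?\<S> \<subseteq> ?\<S>" "image ?t ` ?\<S> \<subseteq> ?\<S>" by blast+
    qed (simp_all add: image_image)
    have "swap_Var u v ?f = esym ?\<S> i (\<lambda>S. (\<lambda>S. \<Prod>a\<in>S. Var a) (?t ` S))"
      unfolding hom_esym[OF is_hom_swap_Var]
      by (intro esym_cong) (simp add: hom_prod[OF is_hom_swap_Var] prod.reindex[OF inj])
    also have "\<dots> = ?f" by (rule esym_reindex[OF bij])
    finally show "\<exists>h. swap_hom Var ?I u v h \<and> (\<forall>g\<in>{}. h g = g) \<and> h ?f = ?f"
      using swap_hom_Var[of "\<lambda>a. a" ?I u v] by (intro exI[of _ "swap_Var u v"]) (auto simp: inj_def)
  qed simp
  then show "?f \<in> alg (elem1 (i*j) ` ?I)"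
  proof (rule alg_trans)
    have "esym ?I k Var \<in> alg (elem1 (i*j) ` ?I)" for k
    proof -
      consider "k = 0" | "k > i*j" | "k \<in> ?I" by force
      then show ?thesis
      proof cases
        case 3
        then have "elem1 (i*j) k \<in> elem1 (i*j) ` ?I" by (intro imageI)
        then show ?thesis by (auto simp: elem1_def intro: alg_gen)
      qed (auto simp: esym_eq_0 alg_0 alg_1)
    qed
    then show "{} \<union> range (\<lambda>k. esym ?I k Var) \<subseteq> alg (elem1 (i*j) ` ?I)" by auto
  qed
qed

lemma
  shows lamPP_vars: "mp_vars (lamPP i j) \<subseteq> {1..i*j}"
    and lamPP_eval: "mpeval (lamPP i j) (elem1 (i*j)) = esym {S. S \<subseteq> {1..i*j} \<and> card S = j} i (\<lambda>S. \<Prod>a\<in>S. Var a)"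
proof -
  let ?f = "esym {S. S \<subseteq> {1..i*j} \<and> card S = j} i (\<lambda>S. \<Prod>a\<in>S. Var a)"
  let ?R = "\<lambda>P. mp_vars P \<subseteq> {1..i*j} \<and>
     (\<forall>x :: nat \<Rightarrow> int.
        mpeval P (\<lambda>v. esym {1..i*j} v x)
        = esym {S. S \<subseteq> {1..i*j} \<and> card S = j} i (\<lambda>S. \<Prod>a\<in>S. x a))"
  obtain P where P: "mp_vars P \<subseteq> {1..i*j}" "mpeval P (elem1 (i*j)) = ?f" using lamPP_mpoly_ex by blast
  have "mpeval P (\<lambda>v. esym {1..i*j} v x)
        = esym {S. S \<subseteq> {1..i*j} \<and> card S = j} i (\<lambda>S. \<Prod>a\<in>S. x a)" for x :: "nat \<Rightarrow> int"
  proof -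
    have "mpeval P (\<lambda>v. mpeval (elem1 (i*j) v) x) = mpeval ?f x"
      by (simp only: P(2)[symmetric] hom_mpeval[OF is_hom_mpeval])
    then show ?thesis
      by (simp add: elem1_eval hom_esym[OF is_hom_mpeval] mpeval_simps)
  qed
  then have RP: "?R P" using P(1) by blast
  have uniq: "Q = P" if "?R Q" for Q
  proof -
    have "Q - P = 0"
    proof (rule mpoly_eq_0_via_surj[of "{1..i*j}" "elem1 (i*j)"])
      show "mp_vars (Q - P) \<subseteq> {1..i*j}"
        using mp_vars_diff[of Q P] RP that by blast
      show "mpeval (Q - P) (\<lambda>v. mpeval (elem1 (i*j) v) x) = 0" for x :: "nat \<Rightarrow> int"
        using RP that by (simp add: mpeval_simps elem1_eval)
    qed (rule elem1_surj)
    then show ?thesis by simp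
  qed
  have "lamPP i j = P" unfolding lamPP_def by (rule the_equality) (fact RP, fact uniq)
  then show "mp_vars (lamPP i j) \<subseteq> {1..i*j}" "mpeval (lamPP i j) (elem1 (i*j)) = ?f" using P by simp_all
qed

section \<open>Newton's identities\<close>

text \<open>Power sums in terms of elementary symmetric functions: the recursion of
  \<open>adams\<close> over any commutative ring and without truncation. The value does not depend
  on \<open>e 0\<close>.\<close>

function newt :: "(nat \<Rightarrow> 'a::comm_ring_1) \<Rightarrow> nat \<Rightarrow> 'a" where
  "newt e k = (\<Sum>i\<in>{1..<k}. (-1) ^ (i + 1) * (e i * newt e (k - i))) + (-1) ^ (k + 1) * of_nat k * e k"
  by auto
termination by (relation "measure snd") auto

declare newt.simps [simp del]

lemma newt_0 [simp]: "newt e 0 = 0"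
  by (subst newt.simps) simp

lemma newt_1: "newt e (Suc 0) = e 1"
  by (subst newt.simps) simp
lemma newt_cong:
  assumes "\<And>i. 1 \<le> i \<Longrightarrow> i \<le> k \<Longrightarrow> e i = e' i"
  shows "newt e k = newt e' k"
  using assms
proof (induction k rule: less_induct)
  case (less k)
  show ?case unfolding newt.simps[of e k] newt.simps[of e' k]
    by (cases "k = 0") (use less in \<open>auto intro!: sum.cong arg_cong2[where f = "(+)"]\<close>)
qed

lemma hom_newt: "is_hom h \<Longrightarrow> h (newt e k) = newt (\<lambda>i. h (e i)) k"
proof (induction k rule: less_induct)
  case (less k)
  show ?case unfolding newt.simps[of e k] newt.simps[of "\<lambda>i. h (e i)" k]
    using less by (auto simp: hom_simps[OF less.prems] intro!: sum.cong)
qed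

text \<open>With the signs absorbed into the power sums, Newton's recursion compares coefficients in
  T E' = E S, where E is the generating series of \<open>e\<close>.\<close>

lemma newt_rec:
  fixes e :: "nat \<Rightarrow> 'a::comm_ring_1"
  shows "of_nat k * e k = (-1) ^ (k + 1) * newt e k + (\<Sum>i\<in>{1..<k}. e i * ((-1) ^ (k - i + 1) * newt e (k - i)))"
proof -
  have sgn: "(-1 :: 'a) ^ (k + 1) * ((-1) ^ (i + 1) * (e i * newt e (k - i))) =
      - (e i * ((-1) ^ (k - i + 1) * newt e (k - i)))" if "i \<in> {1..<k}" for i
  proof -
    have "(-1 :: 'a) ^ (k + 1) * (-1) ^ (i + 1) = (-1) ^ ((k - i) + 2 * (i + 1))"
      using that by (simp add: add.commute flip: power_add)
    also have "\<dots> = - ((-1) ^ (k - i + 1))" unfolding power_add power_mult by simp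
    finally show ?thesis by (simp only: mult.assoc[symmetric] mult_minus_left) (simp add: mult_ac)
  qed
  have "(-1) ^ (k + 1) * newt e k = (\<Sum>i\<in>{1..<k}. - (e i * ((-1) ^ (k - i + 1) * newt e (k - i))))
      + ((-1) ^ (k + 1) * (-1) ^ (k + 1)) * (of_nat k * e k)"
    unfolding newt.simps[of e k] distrib_left sum_distrib_left
    by (rule arg_cong2[where f = "(+)", OF sum.cong[OF refl sgn]]) (simp_all only: mult.assoc)
  also have "(-1 :: 'a) ^ (k + 1) * (-1) ^ (k + 1) = 1" by (simp flip: power_mult_distrib)
  finally show ?thesis by (simp add: sum_negf)
qed

lemma newt_unique:
  assumes "\<And>k. k \<ge> 1 \<Longrightarrow> of_nat k * e k = s k + (\<Sum>i\<in>{1..<k}. e i * s (k - i))"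
    and "k \<ge> 1"
  shows "(-1) ^ (k + 1) * newt e k = s k"
  using assms(2)
proof (induction k rule: less_induct)
  case (less k)
  have "(\<Sum>i\<in>{1..<k}. e i * ((-1) ^ (k - i + 1) * newt e (k - i))) = (\<Sum>i\<in>{1..<k}. e i * s (k - i))"
    by (intro sum.cong refl arg_cong2[where f = times] less.IH) auto
  then show ?case using newt_rec[of k e] assms(1)[OF less.prems] by simp
qed

text \<open>For \<open>e 0 = 1\<close> this is the logarithmic derivative T E'/E of the generating
  series E of \<open>e\<close>.\<close>

definition newt_fps :: "(nat \<Rightarrow> 'a::comm_ring_1) \<Rightarrow> 'a fps" where
  "newt_fps e = Abs_fps (\<lambda>k. (-1) ^ (k + 1) * newt e k)"

lemma fps_newton_iff:
  assumes "e 0 = 1" "s 0 = 0"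
  shows "fps_X * fps_deriv (Abs_fps e) = Abs_fps e * Abs_fps s \<longleftrightarrow>
         (\<forall>k\<ge>1. of_nat k * e k = s k + (\<Sum>i\<in>{1..<k}. e i * s (k - i)))"
proof -
  have l: "fps_nth (fps_X * fps_deriv (Abs_fps e)) k = of_nat k * e k" for k
    by (cases k) auto
  have r: "fps_nth (Abs_fps e * Abs_fps s) k = s k + (\<Sum>i\<in>{1..<k}. e i * s (k - i))" if "k \<ge> 1" for k
  proof -
    \<comment> \<open>The two end terms of the convolution are \<open>e 0 * s k = s k\<close> and
      \<open>e k * s 0 = 0\<close>.\<close>
    have "{0..k} = insert 0 (insert k {1..<k})" using that by auto
    then show ?thesis using that assms by (simp add: fps_mult_nth)
  qed
  have "fps_nth (Abs_fps e * Abs_fps s) 0 = 0" using assms by simp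
  then show ?thesis unfolding fps_eq_iff l using r
    by (metis One_nat_def Suc_leI l mult_zero_left neq0_conv of_nat_0)
qed

lemma fps_newton:
  "e 0 = 1 \<Longrightarrow> fps_X * fps_deriv (Abs_fps e) = Abs_fps e * newt_fps e"
  unfolding newt_fps_def by (subst fps_newton_iff) (use newt_rec[of _ e] in auto)

(* The Newton transform is a logarithmic derivative, hence turns products into sums. *)
lemma newt_convolution:
  assumes "e 0 = 1" "f 0 = 1" "k \<ge> 1"
  shows "newt (\<lambda>k. \<Sum>i\<le>k. e i * f (k - i)) k = newt e k + newt f k"
proof -
  let ?g = "\<lambda>k. \<Sum>i\<le>k. e i * f (k - i)"
  let ?s = "\<lambda>k. (-1) ^ (k + 1) * newt e k + (-1) ^ (k + 1) * newt f k"
  have g: "Abs_fps ?g = Abs_fps e * Abs_fps f"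
    by (rule fps_ext) (simp add: fps_mult_nth atMost_atLeast0)
  have s: "Abs_fps ?s = newt_fps e + newt_fps f"
    by (rule fps_ext) (simp add: newt_fps_def)
  have "fps_X * fps_deriv (Abs_fps ?g) =
      (fps_X * fps_deriv (Abs_fps e)) * Abs_fps f + Abs_fps e * (fps_X * fps_deriv (Abs_fps f))"
    unfolding g by (simp add: algebra_simps)
  also have "\<dots> = Abs_fps ?g * Abs_fps ?s"
    unfolding g s fps_newton[of e, OF assms(1)] fps_newton[of f, OF assms(2)] by (simp add: algebra_simps)
  finally have "\<forall>k\<ge>1. of_nat k * ?g k = ?s k + (\<Sum>i\<in>{1..<k}. ?g i * ?s (k - i))"
    by (subst (asm) fps_newton_iff) (use assms in simp_all)
  then have "(-1) ^ (k + 1) * newt ?g k = ?s k"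
    by (intro newt_unique \<open>k \<ge> 1\<close>) blast
  then have "(-1) ^ (k + 1) * ((-1) ^ (k + 1) * newt ?g k) = (-1) ^ (k + 1) * ?s k" by simp
  moreover have "(-1 :: 'a) ^ (k + 1) * (-1) ^ (k + 1) = 1" by (simp flip: power_mult_distrib)
  ultimately show ?thesis by (simp only: distrib_left mult.assoc[symmetric] mult_1_left)
qed

text \<open>The case E = 1 + a T of a single variable. It starts the computation for several
  variables, evaluates the Adams operations at 1, and for \<open>a = 0\<close> treats vanishing
  sequences.\<close>

lemma newt_single:
  assumes "k \<ge> 1"
  shows "newt (\<lambda>k. if k = 0 then 1 else if k = 1 then a else 0) k = a ^ k"
proof -
  let ?e = "\<lambda>k. if k = 0 then 1 else if k = 1 then a else 0"
  have "(-1) ^ (k + 1) * newt ?e k = (-1) ^ (k + 1) * a ^ k"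
  proof (rule newt_unique[OF _ assms])
    fix k :: nat assume "k \<ge> 1"
    then consider "k = 1" | m where "k = Suc (Suc m)" by (metis One_nat_def Suc_le_D not0_implies_Suc)
    then show "of_nat k * ?e k = (-1) ^ (k + 1) * a ^ k + (\<Sum>i\<in>{1..<k}. ?e i * ((-1) ^ (k - i + 1) * a ^ (k - i)))"
    proof cases
      case (2 m)
      have "?e i * z = (if i = 1 then a * z else 0)" if "i \<in> {1..<k}" for i z
        using that by simp
      then have "(\<Sum>i\<in>{1..<k}. ?e i * ((-1) ^ (k - i + 1) * a ^ (k - i))) =
          (\<Sum>i\<in>{1..<k}. if i = 1 then a * ((-1) ^ (k - i + 1) * a ^ (k - i)) else 0)"
        by (intro sum.cong refl)
      also have "\<dots> = a * ((-1) ^ k * a ^ (k - 1))"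
        unfolding sum.delta[OF finite_atLeastLessThan] using 2 by simp
      finally show ?thesis using 2 by simp
    qed simp
  qed
  then have "(-1) ^ (k + 1) * ((-1) ^ (k + 1) * newt ?e k) = (-1) ^ (k + 1) * ((-1) ^ (k + 1) * a ^ k)" by simp
  moreover have "(-1 :: 'a) ^ (k + 1) * (-1) ^ (k + 1) = 1" by (simp flip: power_mult_distrib)
  ultimately show ?thesis by (simp only: mult.assoc[symmetric] mult_1_left)
qed

text \<open>A new variable multiplies the generating series by 1 + f(a) T, and so adds one power to
  the sum.\<close>

lemma newt_esym:
  fixes f :: "'b \<Rightarrow> 'a::comm_ring_1"
  assumes "finite I" "k \<ge> 1"
  shows "newt (\<lambda>k. esym I k f) k = (\<Sum>a\<in>I. f a ^ k)"
  using assms(1)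
proof (induction I rule: finite_induct)
  case empty
  have "newt (\<lambda>k. esym {} k f) k = newt (\<lambda>k. if k = 0 then 1 else if k = 1 then 0 else 0) k"
    by (rule newt_cong) (auto simp: esym_eq_0)
  then show ?case using newt_single[OF assms(2), of "0 :: 'a"] assms(2) by (simp add: power_0_left)
next
  case (insert a I)
  let ?e = "\<lambda>k. if k = 0 then 1 else if k = 1 then f a else 0"
  have "newt (\<lambda>k. esym (insert a I) k f) k = newt (\<lambda>k. \<Sum>i\<le>k. ?e i * esym I (k - i) f) k"
  proof (rule newt_cong)
    fix i :: nat assume "1 \<le> i"
    then obtain m where m: "i = Suc m" by (cases i) auto
    have "{..i} = insert 0 (insert 1 {2..i})" using m by auto
    then have "(\<Sum>j\<le>i. ?e j * esym I (i - j) f) = esym I i f + f a * esym I m f"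
      by (simp add: m)
    then show "esym (insert a I) i f = (\<Sum>j\<le>i. ?e j * esym I (i - j) f)"
      using insert.hyps by (simp add: m esym_insert)
  qed
  also have "\<dots> = newt ?e k + newt (\<lambda>k. esym I k f) k"
    by (rule newt_convolution) (use insert.hyps assms in auto)
  finally show ?case using insert by (simp add: newt_single[OF assms(2)])
qed

lemma newt_last_eq:
  fixes e e' :: "nat \<Rightarrow> 'a::{idom, ring_char_0}"
  assumes "newt e k = newt e' k" "\<And>i. 1 \<le> i \<Longrightarrow> i < k \<Longrightarrow> e i = e' i" "k \<ge> 1"
  shows "e k = e' k"
proof -
  have "newt e (k - i) = newt e' (k - i)" if "i \<in> {1..<k}" for i
    by (rule newt_cong) (use assms(2) that in auto)
  then have "of_nat k * e k = of_nat k * e' k"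
    unfolding newt_rec[of k e] newt_rec[of k e'] using assms(1,2) by simp
  then show ?thesis using assms(3) by simp
qed

text \<open>The inverse of the Newton transform, scaled to avoid denominators.\<close>

function ehat :: "(nat \<Rightarrow> 'a::comm_ring_1) \<Rightarrow> nat \<Rightarrow> 'a" where
  "ehat p j = (if j = 0 then 1 else
     (\<Sum>l\<in>{1..j}. (-1) ^ (l + 1) * of_nat (fact (j - 1) div fact (j - l)) * (ehat p (j - l) * p l)))"
  by auto
termination by (relation "measure snd") auto

declare ehat.simps [simp del]

lemma ehat_0 [simp]: "ehat p 0 = 1"
  by (subst ehat.simps) simp

lemma ehat_cong:
  assumes "\<And>l. 1 \<le> l \<Longrightarrow> l \<le> j \<Longrightarrow> p l = q l"
  shows "ehat p j = ehat q j"
  using assms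
proof (induction j rule: less_induct)
  case (less j)
  show ?case unfolding ehat.simps[of p j] ehat.simps[of q j]
    by (cases "j = 0") (use less in \<open>auto intro!: sum.cong\<close>)
qed

lemma hom_ehat: "is_hom h \<Longrightarrow> h (ehat p j) = ehat (\<lambda>l. h (p l)) j"
proof (induction j rule: less_induct)
  case (less j)
  show ?case unfolding ehat.simps[of p j] ehat.simps[of "\<lambda>l. h (p l)" j]
    using less by (auto simp: hom_simps[OF less.prems] intro!: sum.cong)
qed

text \<open>Multiply j e_j = sum of (-1)^(l+1) e_(j-l) p_l by (j-1)!. Since l >= 1, the quotient
  (j-1)!/(j-l)! is an integer, and the remaining (j-l)! is absorbed into the earlier value of
  \<open>ehat\<close>.\<close>

lemma ehat_newt:
  assumes "e 0 = 1"
  shows "ehat (newt e) j = of_nat (fact j) * e j"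
proof (induction j rule: less_induct)
  case (less j)
  show ?case
  proof (cases "j = 0")
    case False
    have "ehat (newt e) j = (\<Sum>l\<in>{1..j}. of_nat (fact (j - 1)) * (e (j - l) * ((-1) ^ (l + 1) * newt e l)))"
    proof -
      have "(-1) ^ (l + 1) * of_nat (fact (j - 1) div fact (j - l)) * (ehat (newt e) (j - l) * newt e l)
          = of_nat (fact (j - 1)) * (e (j - l) * ((-1) ^ (l + 1) * newt e l))" if l: "l \<in> {1..j}" for l
      proof -
        have "(fact (j - l) :: nat) dvd fact (j - 1)" by (rule fact_dvd) (use l in auto)
        then have "(fact (j - 1) div fact (j - l)) * fact (j - l) = (fact (j - 1) :: nat)" by simp
        then have d: "of_nat (fact (j - 1) div fact (j - l)) * of_nat (fact (j - l)) = (of_nat (fact (j - 1)) :: 'a)"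
          by (metis of_nat_mult)
        have "ehat (newt e) (j - l) = of_nat (fact (j - l)) * e (j - l)"
          using less l False by simp
        then show ?thesis by (simp only: d[symmetric]) (simp only: mult_ac)
      qed
      then show ?thesis using False by (simp only: ehat.simps[of _ j] if_False) (intro sum.cong refl)
    qed
    also have "\<dots> = of_nat (fact (j - 1)) * (\<Sum>l\<in>{1..j}. e (j - l) * ((-1) ^ (l + 1) * newt e l))"
      by (simp add: sum_distrib_left)
    also have "(\<Sum>l\<in>{1..j}. e (j - l) * ((-1) ^ (l + 1) * newt e l)) =
        (\<Sum>i\<in>{0..<j}. e i * ((-1) ^ (j - i + 1) * newt e (j - i)))"
      by (rule sum.reindex_bij_witness[of _ "\<lambda>i. j - i" "\<lambda>l. j - l"]) auto
    also have "{0..<j} = insert 0 {1..<j}" using False by auto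
    also have "(\<Sum>i\<in>insert 0 {1..<j}. e i * ((-1) ^ (j - i + 1) * newt e (j - i))) = of_nat j * e j"
      using newt_rec[of j e] assms by simp
    finally show ?thesis using False
      by (simp add: fact_reduce[of j] mult_ac)
  qed (use assms in simp)
qed

text \<open>For \<open>j >= 1\<close> neither side depends on \<open>e 0\<close>, which may
  therefore be reset to 1.\<close>

lemma ehat_newt':
  assumes "j \<ge> 1"
  shows "ehat (newt e) j = of_nat (fact j) * e j"
proof -
  have "newt e l = newt (e(0 := 1)) l" for l by (rule newt_cong) auto
  then have "ehat (newt e) j = ehat (newt (e(0 := 1))) j" by (rule ehat_cong)
  then show ?thesis using assms by (simp add: ehat_newt)
qed

text \<open>\<open>ehat\<close> is triangular: \<open>p l\<close> occurs in \<open>ehat p l\<close>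
  with coefficient (l-1)! up to sign, so it can be recovered from this value and the earlier
  entries.\<close>

lemma newt_of_ehat:
  fixes Q :: "nat \<Rightarrow> 'a::{idom, ring_char_0}"
  assumes "\<And>j. j \<ge> 1 \<Longrightarrow> of_nat (fact j) * Q j = ehat p j" and "l \<ge> 1"
  shows "newt Q l = p l"
  using assms(2)
proof (induction l rule: less_induct)
  case (less l)
  have eq: "ehat (newt Q) l = ehat p l"
    using assms(1) less.prems by (simp add: ehat_newt')
  let ?t = "\<lambda>p i. (-1) ^ (i + 1) * of_nat (fact (l - 1) div fact (l - i)) * (ehat p (l - i) * p i)"
  have split: "{1..l} = insert l {1..<l}" using less.prems by auto
  have ex: "ehat r l = ?t r l + (\<Sum>i\<in>{1..<l}. ?t r i)" for r :: "nat \<Rightarrow> 'a"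
    using less.prems by (simp only: ehat.simps[of r l] split) simp
  have "ehat (newt Q) (l - i) = ehat p (l - i)" if "i \<in> {1..<l}" for i
    by (rule ehat_cong) (use that less in auto)
  then have "(\<Sum>i\<in>{1..<l}. ?t (newt Q) i) = (\<Sum>i\<in>{1..<l}. ?t p i)"
    using less by (intro sum.cong refl) auto
  then have "?t (newt Q) l = ?t p l" using eq unfolding ex by simp
  then show ?case by simp
qed

section \<open>Universal identities\<close>

lemma mp_vars_sum: "(\<And>i. i \<in> A \<Longrightarrow> mp_vars (f i) \<subseteq> V) \<Longrightarrow> mp_vars (sum f A) \<subseteq> V"
proof (induction A rule: infinite_finite_induct)
  case (insert x F)
  then show ?case using mp_vars_add[of "f x" "sum f F"] by auto
qed (simp_all add: mp_vars_def)

lemma mp_vars_times: "mp_vars P \<subseteq> V \<Longrightarrow> mp_vars Q \<subseteq> V \<Longrightarrow> mp_vars (P * Q) \<subseteq> V"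
  using mp_vars_mult[of P Q] by blast

lemma mp_vars_plus: "mp_vars P \<subseteq> V \<Longrightarrow> mp_vars Q \<subseteq> V \<Longrightarrow> mp_vars (P + Q) \<subseteq> V"
  using mp_vars_add[of P Q] by blast

lemma mp_vars_minus: "mp_vars P \<subseteq> V \<Longrightarrow> mp_vars Q \<subseteq> V \<Longrightarrow> mp_vars (P - Q) \<subseteq> V"
  using mp_vars_diff[of P Q] by blast

lemma mp_vars_consts: "mp_vars (of_nat m) \<subseteq> V" "mp_vars 1 \<subseteq> V" "mp_vars ((-1) ^ m) \<subseteq> V"
  using mp_vars_of_int[of "int m"] mp_vars_of_int[of 1] mp_vars_of_int[of "(-1) ^ m"] by simp_all

lemma mp_vars_newt:
  assumes "\<And>i. 1 \<le> i \<Longrightarrow> i \<le> k \<Longrightarrow> mp_vars (e i) \<subseteq> V"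
  shows "mp_vars (newt e k) \<subseteq> V"
  using assms
proof (induction k rule: less_induct)
  case (less k)
  show ?case
  proof (cases "k = 0")
    case False
    with less.prems[of k] have "mp_vars (e k) \<subseteq> V" by simp
    moreover have "mp_vars (\<Sum>i\<in>{1..<k}. (-1) ^ (i + 1) * (e i * newt e (k - i))) \<subseteq> V"
      by (intro mp_vars_sum mp_vars_times mp_vars_consts less) (auto intro: less.prems)
    ultimately show ?thesis
      unfolding newt.simps[of e k] by (intro mp_vars_plus mp_vars_times mp_vars_consts)
  qed (simp add: mp_vars_def)
qed

lemma mp_vars_ehat:
  assumes "\<And>l. 1 \<le> l \<Longrightarrow> l \<le> j \<Longrightarrow> mp_vars (p l) \<subseteq> V"
  shows "mp_vars (ehat p j) \<subseteq> V"
  using assms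
proof (induction j rule: less_induct)
  case (less j)
  show ?case
  proof (cases "j = 0")
    case False
    have "mp_vars (\<Sum>l\<in>{1..j}. (-1) ^ (l + 1) * of_nat (fact (j - 1) div fact (j - l)) * (ehat p (j - l) * p l)) \<subseteq> V"
      by (intro mp_vars_sum mp_vars_times mp_vars_consts less) (auto intro: less.prems)
    then show ?thesis using False by (simp only: ehat.simps[of p j] if_False)
  qed (simp add: mp_vars_consts)
qed

lemma power_sum_prod:
  "(\<Sum>(a, b)\<in>A \<times> B. (f a * g b) ^ k) = (\<Sum>a\<in>A. f a ^ k) * (\<Sum>b\<in>B. (g b :: 'a::comm_ring_1) ^ k)"
  by (simp add: sum_product sum.cartesian_product power_mult_distrib)

(* lamP k is defined through k + k variables; that it computes the k-th elementary symmetric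
   function of the products for any number of variables follows from the Newton identity,
   by induction on k. *)
lemma lamP_newt_and_stable:
  assumes "k \<ge> 1"
  shows "newt lamP k = newt VarX k * newt VarY k \<and>
    (\<forall>N. mpeval (lamP k) (elem2 N) = esym ({1..N} \<times> {1..N}) k (\<lambda>(a, b). VarX a * VarY b))"
  using assms
proof (induction k rule: less_induct)
  case (less k)
  let ?V = "{v. 1 \<le> v div 2 \<and> v div 2 \<le> k}"
  let ?E = "\<lambda>N k. esym ({1..N} \<times> {1..N}) k (\<lambda>(a, b). VarX a * VarY b)"
  have R: "mpeval (newt VarX k * newt VarY k) (elem2 N) = newt (?E N) k" for N
  proof -
    have "mpeval (newt VarX k * newt VarY k) (elem2 N) =
        newt (\<lambda>i. elem2 N (2 * i)) k * newt (\<lambda>i. elem2 N (2 * i + 1)) k"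
      by (simp add: mpeval_simps hom_newt[OF is_hom_mpeval])
    also have "\<dots> = newt (\<lambda>i. esym {1..N} i VarX) k * newt (\<lambda>i. esym {1..N} i VarY) k"
      by (simp add: elem2_def)
    also have "\<dots> = (\<Sum>a\<in>{1..N}. VarX a ^ k) * (\<Sum>a\<in>{1..N}. VarY a ^ k)"
      using less.prems by (simp add: newt_esym)
    also have "\<dots> = newt (?E N) k"
      using less.prems by (simp add: newt_esym power_sum_prod[symmetric] case_prod_unfold)
    finally show ?thesis .
  qed
  have L: "mpeval (newt lamP k) f = newt (\<lambda>i. mpeval (lamP i) f) k" for f :: "nat \<Rightarrow> int_mpoly"
    by (rule hom_newt[OF is_hom_mpeval])
  have IH: "mpeval (lamP i) (elem2 N) = ?E N i" if "1 \<le> i" "i < k" for i N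
    using less.IH[of i] that by blast
  let ?W = "newt lamP k - newt VarX k * newt VarY k"
  \<comment> \<open>Below \<open>k\<close> the induction hypothesis permits any number of variables;
    at \<open>k\<close> only the defining number \<open>k\<close> is available so far.\<close>
  have "newt (\<lambda>i. mpeval (lamP i) (elem2 k)) k = newt (?E k) k"
    by (rule newt_cong) (use IH lamP_eval[of k] in \<open>force simp: le_less\<close>)
  then have W: "mpeval ?W (elem2 k) = 0"
    unfolding mpeval_simps(6) L R by simp
  have "?W = 0"
  proof (rule mpoly_eq_0_via_surj[of ?V "elem2 k"])
    have "mp_vars (lamP i) \<subseteq> ?V" if "i \<le> k" for i
      using lamP_vars[of i] that by force
    moreover have "mp_vars (VarX i) \<subseteq> ?V" "mp_vars (VarY i) \<subseteq> ?V" if "1 \<le> i" "i \<le> k" for i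
      using mp_vars_Var[of "2 * i"] mp_vars_Var[of "2 * i + 1"] that by fastforce+
    ultimately show "mp_vars ?W \<subseteq> ?V"
      by (intro mp_vars_minus mp_vars_times mp_vars_newt)
    show "mpeval ?W (\<lambda>v. mpeval (elem2 k v) x) = 0" for x :: "nat \<Rightarrow> int"
      using W by (simp add: mpeval_simps(4) flip: hom_mpeval[OF is_hom_mpeval])
  qed (rule elem2_surj)
  then have eq: "newt lamP k = newt VarX k * newt VarY k" by simp
  moreover have "mpeval (lamP k) (elem2 N) = ?E N k" for N
  proof (rule newt_last_eq[of "\<lambda>i. mpeval (lamP i) (elem2 N)" k "?E N"])
    show "newt (\<lambda>i. mpeval (lamP i) (elem2 N)) k = newt (?E N) k"
      unfolding L[symmetric] eq R ..
  qed (use IH less.prems in auto)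
  ultimately show ?case by blast
qed

lemmas lamP_newt = lamP_newt_and_stable[THEN conjunct1]

text \<open>The i-th power sum of the products x_S over j-subsets S is the j-th elementary symmetric
  function of the powers x_a^i, whose l-th power sum is p_(il). The factor \<open>fact j\<close>
  keeps this integral; independence of the number \<open>N\<close> of variables follows by the same
  induction as for \<open>lamP\<close>.\<close>

lemma lamPP_newt_and_stable:
  assumes "i \<ge> 1" "j \<ge> 1"
  shows "of_nat (fact j) * newt (\<lambda>i. lamPP i j) i = ehat (\<lambda>l. newt Var (i * l)) j \<and>
    (\<forall>N. mpeval (lamPP i j) (elem1 N) = esym {S. S \<subseteq> {1..N} \<and> card S = j} i (\<lambda>S. \<Prod>a\<in>S. Var a))"
  using assms(1)
proof (induction i rule: less_induct)
  case (less i)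
  let ?E = "\<lambda>N i. esym {S. S \<subseteq> {1..N} \<and> card S = j} i (\<lambda>S. \<Prod>a\<in>S. Var a)"
  have R: "mpeval (ehat (\<lambda>l. newt Var (i * l)) j) (elem1 N) = of_nat (fact j) * newt (?E N) i" for N
  proof -
    have "mpeval (ehat (\<lambda>l. newt Var (i * l)) j) (elem1 N) =
        ehat (\<lambda>l. newt (\<lambda>v. esym {1..N} v Var) (i * l)) j"
      by (simp add: hom_ehat[OF is_hom_mpeval] hom_newt[OF is_hom_mpeval] elem1_def)
    also have "\<dots> = ehat (\<lambda>l. newt (\<lambda>v. esym {1..N} v (\<lambda>a. Var a ^ i)) l) j"
      by (rule ehat_cong) (use less.prems in \<open>simp add: newt_esym power_mult\<close>)
    also have "\<dots> = of_nat (fact j) * esym {1..N} j (\<lambda>a. Var a ^ i)"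
      by (rule ehat_newt) simp
    also have "esym {1..N} j (\<lambda>a. Var a ^ i) = newt (?E N) i"
      using less.prems by (subst newt_esym) (simp_all add: esym_def prod_power_distrib)
    finally show ?thesis .
  qed
  have L: "mpeval (newt (\<lambda>i. lamPP i j) i) f = newt (\<lambda>i. mpeval (lamPP i j) f) i" for f :: "nat \<Rightarrow> int_mpoly"
    by (rule hom_newt[OF is_hom_mpeval])
  have IH: "mpeval (lamPP i' j) (elem1 N) = ?E N i'" if "1 \<le> i'" "i' < i" for i' N
    using less.IH[of i'] that by blast
  let ?W = "of_nat (fact j) * newt (\<lambda>i. lamPP i j) i - ehat (\<lambda>l. newt Var (i * l)) j"
  have "newt (\<lambda>i'. mpeval (lamPP i' j) (elem1 (i*j))) i = newt (?E (i*j)) i"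
    by (rule newt_cong) (use IH lamPP_eval[of i j] in \<open>force simp: le_less\<close>)
  then have W: "mpeval ?W (elem1 (i*j)) = 0"
    unfolding mpeval_simps(6) mpeval_simps(2) mpeval_simps(10) L R by simp
  have "?W = 0"
  proof (rule mpoly_eq_0_via_surj[of "{1..i*j}" "elem1 (i*j)"])
    have 1: "mp_vars (lamPP i' j) \<subseteq> {1..i*j}" if "i' \<le> i" for i'
    proof -
      have "{1..i'*j} \<subseteq> {1..i*j}" using mult_le_mono1[OF that, of j] by auto
      then show ?thesis using lamPP_vars[of i' j] by blast
    qed
    have 2: "mp_vars (newt Var (i * l)) \<subseteq> {1..i*j}" if "l \<le> j" for l
    proof (rule mp_vars_newt)
      fix v assume "1 \<le> v" "v \<le> i * l"
      then have "v \<in> {1..i*j}" using order.trans[OF _ mult_le_mono2[OF that, of i]] by simp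
      then show "mp_vars (Var v) \<subseteq> {1..i*j}" using mp_vars_Var[of v] by blast
    qed
    show "mp_vars ?W \<subseteq> {1..i*j}"
      by (rule mp_vars_minus[OF mp_vars_times[OF mp_vars_consts(1) mp_vars_newt[OF 1]] mp_vars_ehat[OF 2]])
    show "mpeval ?W (\<lambda>v. mpeval (elem1 (i*j) v) x) = 0" for x :: "nat \<Rightarrow> int"
      using W by (simp add: mpeval_simps(4) flip: hom_mpeval[OF is_hom_mpeval])
  qed (rule elem1_surj)
  then have eq: "of_nat (fact j) * newt (\<lambda>i. lamPP i j) i = ehat (\<lambda>l. newt Var (i * l)) j" by simp
  moreover have "mpeval (lamPP i j) (elem1 N) = ?E N i" for N
  proof (rule newt_last_eq[of "\<lambda>i. mpeval (lamPP i j) (elem1 N)" i "?E N"])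
    have "of_nat (fact j) * newt (\<lambda>i. mpeval (lamPP i j) (elem1 N)) i = of_nat (fact j) * newt (?E N) i"
      unfolding L[symmetric] R[symmetric] eq[symmetric] mpeval_simps(2) mpeval_simps(10) ..
    then show "newt (\<lambda>i. mpeval (lamPP i j) (elem1 N)) i = newt (?E N) i" by simp
  qed (use IH less.prems in auto)
  ultimately show ?case by blast
qed

text \<open>The universal form of psi^r psi^l = psi^(rl): the inner transform gives e_j of the r-th
  powers, and the l-th power sum of r-th powers is p_(rl).\<close>

lemma lamPP_newt:
  assumes "r \<ge> 1" "l \<ge> 1"
  shows "newt (\<lambda>j. newt (\<lambda>i. lamPP i j) r) l = newt Var (r * l)"
  by (rule newt_of_ehat) (use lamPP_newt_and_stable assms in auto)

section \<open>Arithmetic modulo a power of the variable\<close>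

lemma coeff_trunc: "coeff (trunc n p) j = (if j < n then coeff p j else 0)"
  by (simp add: trunc_def coeff_sum if_distrib[of "\<lambda>x. x = _"] eq_commute cong: if_cong)

text \<open>Congruence modulo x^n. Working with representatives keeps the ring laws of
  \<open>int poly\<close>, which \<open>tmul\<close> as an operation on truncations would
  hide.\<close>

definition teq :: "nat \<Rightarrow> int poly \<Rightarrow> int poly \<Rightarrow> bool" where
  "teq n p q \<longleftrightarrow> trunc n p = trunc n q"

lemma teq_iff: "teq n p q \<longleftrightarrow> (\<forall>j<n. coeff p j = coeff q j)"
  by (auto simp: teq_def poly_eq_iff coeff_trunc)

lemma teq_refl [simp]: "teq n p p"
  by (simp add: teq_def)

lemma teq_sym: "teq n p q \<Longrightarrow> teq n q p"
  by (simp add: teq_def)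

lemma teq_trans [trans]: "teq n p q \<Longrightarrow> teq n q r \<Longrightarrow> teq n p r"
  by (simp add: teq_def)

lemma teq_trunc: "teq n (trunc n p) p"
  by (simp add: teq_iff coeff_trunc)

lemma teq_add: "teq n p p' \<Longrightarrow> teq n q q' \<Longrightarrow> teq n (p + q) (p' + q')"
  by (simp add: teq_iff)

lemma teq_mult: "teq n p p' \<Longrightarrow> teq n q q' \<Longrightarrow> teq n (p * q) (p' * q')"
  by (auto simp: teq_iff coeff_mult intro!: sum.cong)

lemma teq_sum: "(\<And>i. i \<in> A \<Longrightarrow> teq n (f i) (g i)) \<Longrightarrow> teq n (sum f A) (sum g A)"
  by (simp add: teq_iff coeff_sum)

lemma teq_newt:
  assumes "\<And>i. 1 \<le> i \<Longrightarrow> i \<le> k \<Longrightarrow> teq n (e i) (e' i)"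
  shows "teq n (newt e k) (newt e' k)"
  using assms
proof (induction k rule: less_induct)
  case (less k)
  show ?case
  proof (cases "k = 0")
    case False
    show ?thesis unfolding newt.simps[of e k] newt.simps[of e' k]
      by (intro teq_add teq_sum teq_mult teq_refl less.prems less.IH) (use False in auto)
  qed simp
qed

text \<open>Newton's recursion determines \<open>k * e k\<close>, and integer coefficients allow
  \<open>k\<close> to be cancelled. Hence Adams operations determine the lambda operations.\<close>

lemma teq_newtD:
  assumes "\<And>k. k \<ge> 1 \<Longrightarrow> teq n (newt e k) (newt e' k)" and "k \<ge> 1"
  shows "teq n (e k) (e' k)"
  using assms(2)
proof (induction k rule: less_induct)
  case (less k)
  have "teq n (of_nat k * e k) (of_nat k * e' k)"
    unfolding newt_rec[of k e] newt_rec[of k e']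
    by (intro teq_add teq_sum teq_mult teq_refl assms(1) less.IH) (use less.prems in auto)
  then show ?case using less.prems
    by (simp add: teq_iff of_nat_poly)
qed

lemma trunc_in_carrier [simp]: "trunc n p \<in> trunc_carrier n"
  by (simp add: trunc_carrier_def coeff_trunc)

lemma trunc_carrier_eq: "p \<in> trunc_carrier n \<Longrightarrow> trunc n p = p"
  by (auto simp: trunc_carrier_def poly_eq_iff coeff_trunc)

lemma teq_carrier: "teq n p q \<Longrightarrow> p \<in> trunc_carrier n \<Longrightarrow> q \<in> trunc_carrier n \<Longrightarrow> p = q"
  by (simp add: teq_def trunc_carrier_eq)

lemma trunc_carrier_add: "p \<in> trunc_carrier n \<Longrightarrow> q \<in> trunc_carrier n \<Longrightarrow> p + q \<in> trunc_carrier n"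
  and trunc_carrier_zero: "0 \<in> trunc_carrier n"
  and trunc_carrier_one: "n \<ge> 1 \<Longrightarrow> 1 \<in> trunc_carrier n"
  and trunc_carrier_X: "n \<ge> 2 \<Longrightarrow> [:0, 1:] \<in> trunc_carrier n"
  by (auto simp: trunc_carrier_def coeff_1 coeff_pCons split: nat.splits)

lemma trunc_add: "trunc n (p + q) = trunc n p + trunc n q"
  by (simp add: poly_eq_iff coeff_trunc)

lemma tmul_in_carrier: "tmul n p q \<in> trunc_carrier n"
  by (simp add: tmul_def)

section \<open>Substitution modulo a power of the variable\<close>

lemma is_hom_pcompose: "is_hom (\<lambda>p. p \<circ>\<^sub>p c)"
  by (simp add: is_hom_def pcompose_add pcompose_mult pcompose_1)

lemma coeff_pcompose_low:
  assumes "coeff c 0 = 0" "\<And>i. i < m \<Longrightarrow> coeff f i = 0" "j < m"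
  shows "coeff (f \<circ>\<^sub>p c) j = (0::int)"
  using assms(2,3)
proof (induction m arbitrary: f j)
  case (Suc m)
  obtain a g where f: "f = pCons a g" by (cases f)
  have "a = 0" using Suc.prems(1)[of 0] by (simp add: f)
  have g: "coeff (g \<circ>\<^sub>p c) i = 0" if "i < m" for i
    by (rule Suc.IH[OF _ that]) (use Suc.prems(1)[of "Suc _"] in \<open>simp add: f\<close>)
  have "coeff (c * (g \<circ>\<^sub>p c)) j = 0"
    unfolding coeff_mult
  proof (rule sum.neutral, rule ballI)
    fix i assume "i \<in> {..j}"
    then show "coeff c i * coeff (g \<circ>\<^sub>p c) (j - i) = 0"
      using g[of "j - i"] assms(1) Suc.prems(2) by (cases "i = 0") auto
  qed
  then show ?case by (simp add: f \<open>a = 0\<close> pcompose_pCons)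
qed simp

text \<open>Substituting a polynomial without constant term maps the ideal (x^n) into
  itself.\<close>

lemma teq_pcompose_left:
  assumes "teq n f g" "coeff c 0 = 0"
  shows "teq n (f \<circ>\<^sub>p c) (g \<circ>\<^sub>p c)"
proof -
  have "coeff ((f - g) \<circ>\<^sub>p c) j = 0" if "j < n" for j
    by (rule coeff_pcompose_low[OF assms(2) _ that]) (use assms(1) in \<open>simp add: teq_iff\<close>)
  then show ?thesis by (simp add: teq_iff pcompose_diff)
qed

lemma teq_pcompose_right:
  assumes "teq n c d"
  shows "teq n (f \<circ>\<^sub>p c) (f \<circ>\<^sub>p d)"
  by (induction f) (auto simp: pcompose_pCons intro!: teq_add teq_mult assms)

lemma teq_monom_top:
  assumes "n \<ge> 1"
  shows "teq n (monom b (n - 1) * h) (monom (b * coeff h 0) (n - 1))"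
  using assms by (auto simp: teq_iff coeff_monom_mult)

text \<open>First-order expansion: multiplication by x^(n-1) sees only constant terms, so f(g + c
  x^(n-1)) changes by f'(0) c x^(n-1), and b times the (n-1)-st power of g + c x^(n-1) leaves only
  the linear coefficient of g. Here \<open>n >= 3\<close> ensures that the perturbation does not
  touch that linear coefficient.\<close>

lemma teq_pcompose_perturb:
  fixes f g :: "int poly"
  assumes "n \<ge> 3" "coeff g 0 = 0"
  shows "teq n ((f + monom b (n - 1)) \<circ>\<^sub>p (g + monom c (n - 1)))
     (f \<circ>\<^sub>p g + monom (coeff f 1 * c + b * coeff g 1 ^ (n - 1)) (n - 1))"
proof -
  let ?m = "monom c (n - 1)"
  have n1: "n \<ge> 1" using assms by simp
  have f: "teq n (f \<circ>\<^sub>p (g + ?m)) (f \<circ>\<^sub>p g + monom (coeff f 1 * c) (n - 1))"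
  proof (induction f)
    case (pCons a p)
    let ?l = "monom (coeff p 1 * c) (n - 1)"
    have "teq n (pCons a p \<circ>\<^sub>p (g + ?m)) ([:a:] + (g + ?m) * (p \<circ>\<^sub>p g + ?l))"
      unfolding pcompose_pCons by (intro teq_add teq_mult teq_refl pCons.IH)
    also have "[:a:] + (g + ?m) * (p \<circ>\<^sub>p g + ?l) = [:a:] + g * (p \<circ>\<^sub>p g) + (?m * (p \<circ>\<^sub>p g) + ?l * (g + ?m))"
      by (simp add: algebra_simps)
    also have "teq n \<dots> ([:a:] + g * (p \<circ>\<^sub>p g) +
        (monom (c * coeff (p \<circ>\<^sub>p g) 0) (n - 1) + monom ((coeff p 1 * c) * coeff (g + ?m) 0) (n - 1)))"
      by (intro teq_add teq_refl teq_monom_top n1)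
    also have "\<dots> = pCons a p \<circ>\<^sub>p g + monom (coeff (pCons a p) 1 * c) (n - 1)"
      using assms by (simp add: pcompose_pCons poly_0_coeff_0 mult.commute)
    finally show ?case .
  qed simp
  have b: "teq n (monom b (n - 1) \<circ>\<^sub>p (g + ?m)) (monom (b * coeff g 1 ^ (n - 1)) (n - 1))"
  proof -
    obtain h where h: "g + ?m = pCons 0 h"
      using assms by (cases "g + ?m") (metis coeff_add coeff_monom coeff_pCons_0 add_0 One_nat_def diff_is_0_eq numeral_le_one_iff order.trans semiring_norm(70))
    have h0: "coeff h 0 = coeff g 1"
    proof -
      have "coeff h 0 = coeff (g + ?m) 1" unfolding h by simp
      moreover have "n - 1 \<noteq> 1" using assms by simp
      ultimately show ?thesis by simp
    qed
    have "monom b (n - 1) \<circ>\<^sub>p (g + ?m) = [:b:] * (g + ?m) ^ (n - 1)"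
      by (simp add: monom_altdef pcompose_smult hom_power[OF is_hom_pcompose] pcompose_pCons)
    also have "\<dots> = monom b (n - 1) * h ^ (n - 1)"
    proof -
      have "g + ?m = [:0, 1:] * h" unfolding h by simp
      then show ?thesis by (simp only: power_mult_distrib monom_altdef[of b]) simp
    qed
    also have "teq n \<dots> (monom (b * coeff (h ^ (n - 1)) 0) (n - 1))"
      by (rule teq_monom_top[OF n1])
    finally show ?thesis by (simp add: h0 coeff_0_power)
  qed
  show ?thesis
    unfolding pcompose_add using teq_add[OF f b] by (simp add: add_monom add.assoc)
qed

section \<open>Adams operations\<close>

declare adams.simps [simp del]

text \<open>Truncating at every stage of the recursion or once at the end gives the same
  result.\<close>

lemma adams_eq: "adams n lam k a = trunc n (newt (\<lambda>i. lam i a) k)"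
proof (induction k rule: less_induct)
  case (less k)
  have smult: "smult ((-1) ^ m) p = (-1) ^ m * p" "smult ((-1) ^ m * int k) p = (-1) ^ m * of_nat k * p"
    for m and p :: "int poly"
    by (cases "even m"; simp add: of_nat_poly)+
  have "teq n (adams n lam k a) (newt (\<lambda>i. lam i a) k)"
    unfolding adams.simps[of n lam k a] newt.simps[of _ k] smult
  proof (rule teq_trans[OF teq_trunc], intro teq_add teq_sum teq_mult teq_refl)
    fix i assume "i \<in> {1..<k}"
    then show "teq n (adams n lam (k - i) a) (newt (\<lambda>i. lam i a) (k - i))"
      by (subst less) (auto simp: teq_trunc)
  qed
  moreover have "trunc n (adams n lam k a) = adams n lam k a"
    by (rule trunc_carrier_eq) (subst adams.simps, simp)
  ultimately show ?case by (simp add: teq_def)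
qed

lemma adams_in_carrier [simp]: "adams n lam k a \<in> trunc_carrier n"
  by (simp add: adams_eq)

context
  fixes n :: nat and lam :: "nat \<Rightarrow> int poly \<Rightarrow> int poly"
  assumes L: "is_lambda_ring n lam" and n: "n \<ge> 2"
begin

lemma lam_in_carrier: "a \<in> trunc_carrier n \<Longrightarrow> lam i a \<in> trunc_carrier n"
  and lam_0: "a \<in> trunc_carrier n \<Longrightarrow> lam 0 a = 1"
  and lam_1: "a \<in> trunc_carrier n \<Longrightarrow> lam 1 a = a"
  and lam_add: "a \<in> trunc_carrier n \<Longrightarrow> b \<in> trunc_carrier n \<Longrightarrow>
         lam k (a + b) = trunc n (\<Sum>i\<le>k. lam i a * lam (k - i) b)"
  and lam_one: "k \<ge> 2 \<Longrightarrow> lam k 1 = 0"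
  and lam_tmul: "k \<ge> 1 \<Longrightarrow> a \<in> trunc_carrier n \<Longrightarrow> b \<in> trunc_carrier n \<Longrightarrow>
         lam k (tmul n a b) =
           trunc n (mpeval (lamP k) (\<lambda>v. if even v then lam (v div 2) a else lam (v div 2) b))"
  and lam_lam: "i \<ge> 1 \<Longrightarrow> j \<ge> 1 \<Longrightarrow> a \<in> trunc_carrier n \<Longrightarrow>
         lam i (lam j a) = trunc n (mpeval (lamPP i j) (\<lambda>v. lam v a))"
  using L unfolding is_lambda_ring_def by blast+

lemma adams_1: "a \<in> trunc_carrier n \<Longrightarrow> adams n lam 1 a = a"
  by (simp add: adams_eq newt_1 lam_1[unfolded One_nat_def] trunc_carrier_eq)

lemma adams_add:
  assumes "a \<in> trunc_carrier n" "b \<in> trunc_carrier n" "k \<ge> 1"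
  shows "adams n lam k (a + b) = adams n lam k a + adams n lam k b"
proof -
  have "teq n (newt (\<lambda>i. lam i (a + b)) k) (newt (\<lambda>k. \<Sum>i\<le>k. lam i a * lam (k - i) b) k)"
    by (rule teq_newt) (simp add: lam_add assms teq_trunc)
  also have "\<dots> = newt (\<lambda>i. lam i a) k + newt (\<lambda>i. lam i b) k"
    by (rule newt_convolution) (use assms lam_0 in auto)
  finally show ?thesis by (simp add: adams_eq teq_def trunc_add)
qed

lemma adams_tmul:
  assumes "a \<in> trunc_carrier n" "b \<in> trunc_carrier n" "k \<ge> 1"
  shows "adams n lam k (tmul n a b) = tmul n (adams n lam k a) (adams n lam k b)"
proof -
  let ?g = "\<lambda>v. if even v then lam (v div 2) a else lam (v div 2) b"
  have "teq n (newt (\<lambda>i. lam i (tmul n a b)) k) (newt (\<lambda>i. mpeval (lamP i) ?g) k)"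
    by (rule teq_newt) (simp add: lam_tmul assms teq_trunc)
  also have "\<dots> = mpeval (newt lamP k) ?g"
    by (simp add: hom_newt[OF is_hom_mpeval])
  also have "\<dots> = newt (\<lambda>i. lam i a) k * newt (\<lambda>i. lam i b) k"
    unfolding lamP_newt[OF assms(3)] by (simp add: mpeval_simps hom_newt[OF is_hom_mpeval])
  also have "teq n \<dots> (adams n lam k a * adams n lam k b)"
    unfolding adams_eq by (intro teq_mult teq_sym[OF teq_trunc])
  finally show ?thesis unfolding adams_eq[of n lam k "tmul n a b"] unfolding teq_def tmul_def .
qed

lemma adams_one: "k \<ge> 1 \<Longrightarrow> adams n lam k 1 = 1"
proof -
  assume k: "k \<ge> 1"
  have one: "1 \<in> trunc_carrier n" using n by (simp add: trunc_carrier_one)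
  have "newt (\<lambda>i. lam i 1) k = newt (\<lambda>k. if k = 0 then 1 else if k = 1 then 1 else 0) k"
    by (rule newt_cong) (use lam_1[OF one] lam_one in auto)
  then show ?thesis using newt_single[OF k, of "1 :: int poly"] one
    by (simp add: adams_eq trunc_carrier_eq)
qed

text \<open>A map respecting 1, sums and products is determined by the image of x. Integer constants
  are reached from 1 by additivity, and \<open>trunc n f\<close> admits an arbitrary polynomial
  \<open>f\<close> for the induction.\<close>

lemma adams_pcompose:
  assumes k: "k \<ge> 1"
  shows "teq n (adams n lam k (trunc n f)) (f \<circ>\<^sub>p adams n lam k [:0, 1:])"
proof (induction f)
  case 0
  have "adams n lam k (0 + 0) = adams n lam k 0 + adams n lam k 0"
    by (rule adams_add) (use k trunc_carrier_zero in auto)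
  moreover have "trunc n 0 = 0" by (simp add: trunc_carrier_eq trunc_carrier_zero)
  ultimately show ?case by simp
next
  case (pCons a p)
  let ?T = "\<lambda>f. adams n lam k (trunc n f)"
  have one: "trunc n 1 = 1" using n by (simp add: trunc_carrier_eq trunc_carrier_one)
  have add: "?T (f + g) = ?T f + ?T g" for f g
    unfolding trunc_add by (rule adams_add) (use k in auto)
  have T1: "?T 1 = 1" unfolding one by (rule adams_one[OF k])
  have T0: "?T 0 = 0" using add[of 0 0] by simp
  have nat: "?T (of_nat m) = of_nat m" for m by (induction m) (simp_all add: T0 T1 add)
  have int: "?T (of_int a) = of_int a"
  proof (cases a)
    case (nonneg m)
    then show ?thesis using nat by simp
  next
    case (neg m)
    have "?T (of_int a) + ?T (of_nat (Suc m)) = 0" unfolding add[symmetric] using T0 neg by simp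
    then show ?thesis unfolding nat using neg by (simp add: eq_neg_iff_add_eq_0)
  qed
  have X: "trunc n [:0, 1:] = [:0, 1:]" using n by (simp add: trunc_carrier_eq trunc_carrier_X)
  have "pCons a p = of_int a + [:0, 1:] * p" by (simp add: of_int_poly)
  then have "?T (pCons a p) = of_int a + ?T ([:0, 1:] * p)" by (simp only: add int)
  also have "trunc n ([:0, 1:] * p) = tmul n [:0, 1:] (trunc n p)"
    unfolding tmul_def using teq_mult[OF teq_refl teq_trunc, of n "[:0, 1:]" p] by (simp add: teq_def)
  also have "adams n lam k \<dots> = tmul n (adams n lam k [:0, 1:]) (?T p)"
    by (rule adams_tmul) (use n k in \<open>auto simp: trunc_carrier_X\<close>)
  also have "teq n (of_int a + tmul n (adams n lam k [:0, 1:]) (?T p))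
      (of_int a + adams n lam k [:0, 1:] * (p \<circ>\<^sub>p adams n lam k [:0, 1:]))"
    unfolding tmul_def by (intro teq_add teq_refl teq_trans[OF teq_trunc] teq_mult pCons.IH)
  finally show ?case by (simp add: pcompose_pCons of_int_poly)
qed

lemma adams_pcompose': "k \<ge> 1 \<Longrightarrow> f \<in> trunc_carrier n \<Longrightarrow>
    teq n (adams n lam k f) (f \<circ>\<^sub>p adams n lam k [:0, 1:])"
  using adams_pcompose[of k f] by (simp add: trunc_carrier_eq)

text \<open>As a substitution, psi^r passes inside the Newton expression of psi^l. Each
  psi^r(lambda^j a) then expands through the polynomials \<open>lamPP\<close>, and
  \<open>lamPP_newt\<close> collapses the double transform.\<close>

lemma adams_adams:
  assumes r: "r \<ge> 1" and l: "l \<ge> 1" and a: "a \<in> trunc_carrier n"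
  shows "adams n lam r (adams n lam l a) = adams n lam (r * l) a"
proof -
  let ?c = "adams n lam r [:0, 1:]"
  let ?Q = "\<lambda>j. newt (\<lambda>i. lamPP i j) r"
  have "teq n (adams n lam r (adams n lam l a)) (newt (\<lambda>j. lam j a) l \<circ>\<^sub>p ?c)"
    unfolding adams_eq[of n lam l a] by (rule adams_pcompose[OF r])
  also have "\<dots> = newt (\<lambda>j. lam j a \<circ>\<^sub>p ?c) l" by (rule hom_newt[OF is_hom_pcompose])
  also have "teq n \<dots> (newt (\<lambda>j. mpeval (?Q j) (\<lambda>v. lam v a)) l)"
  proof (rule teq_newt)
    fix j :: nat assume j: "1 \<le> j"
    have "teq n (lam j a \<circ>\<^sub>p ?c) (adams n lam r (lam j a))"
      by (rule teq_sym[OF adams_pcompose'[OF r]]) (simp add: lam_in_carrier a)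
    also have "\<dots> = trunc n (newt (\<lambda>i. lam i (lam j a)) r)" by (rule adams_eq)
    also have "teq n \<dots> (newt (\<lambda>i. lam i (lam j a)) r)" by (rule teq_trunc)
    also have "teq n \<dots> (newt (\<lambda>i. mpeval (lamPP i j) (\<lambda>v. lam v a)) r)"
      by (rule teq_newt) (simp add: lam_lam[OF _ j a] teq_trunc)
    also have "\<dots> = mpeval (?Q j) (\<lambda>v. lam v a)" by (simp add: hom_newt[OF is_hom_mpeval])
    finally show "teq n (lam j a \<circ>\<^sub>p ?c) (mpeval (?Q j) (\<lambda>v. lam v a))" .
  qed
  also have "\<dots> = mpeval (newt ?Q l) (\<lambda>v. lam v a)" by (simp add: hom_newt[OF is_hom_mpeval])
  also have "\<dots> = newt (\<lambda>v. lam v a) (r * l)"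
    unfolding lamPP_newt[OF r l] by (simp add: hom_newt[OF is_hom_mpeval])
  also have "teq n \<dots> (adams n lam (r * l) a)" unfolding adams_eq by (rule teq_sym[OF teq_trunc])
  finally show ?thesis by (rule teq_carrier) simp_all
qed

end

text \<open>A product of two polynomials without constant term has no linear term, so only the
  summand with factor \<open>k\<close> contributes to the linear coefficient.\<close>

lemma coeff_newt_low:
  fixes e :: "nat \<Rightarrow> int poly"
  assumes "\<And>i. i \<ge> 1 \<Longrightarrow> coeff (e i) 0 = 0"
  shows "coeff (newt e k) 0 = 0" "int k dvd coeff (newt e k) 1"
proof -
  have hom: "is_hom (\<lambda>p :: int poly. coeff p 0)" by (simp add: is_hom_def coeff_mult)
  show 0: "coeff (newt e k) 0 = 0" for k
  proof (cases "k = 0")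
    case False
    have "coeff (newt e k) 0 = newt (\<lambda>i. coeff (e i) 0) k" by (rule hom_newt[OF hom])
    also have "\<dots> = newt (\<lambda>i. if i = 0 then 1 else if i = 1 then 0 else 0) k"
      by (rule newt_cong) (use assms in auto)
    finally show ?thesis using False newt_single[of k "0::int"] by (simp add: power_0_left)
  qed simp
  have prod: "coeff (p * q) 1 = 0" if "coeff p 0 = 0" "coeff q 0 = 0" for p q :: "int poly"
    using that by (simp add: coeff_mult)
  have sgn: "coeff ((-1) ^ m * p) 1 = (-1) ^ m * coeff p 1" for m and p :: "int poly"
    by (cases "even m") simp_all
  have "coeff (newt e k) 1 = (-1) ^ (k + 1) * (int k * coeff (e k) 1)"
    unfolding newt.simps[of e k] coeff_add coeff_sum sgn mult.assoc
    using prod[OF assms 0] by (simp add: of_nat_poly)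
  then show "int k dvd coeff (newt e k) 1" by simp
qed

text \<open>Filtration level \<open>d >= 1\<close> excludes constant terms, because
  \<open>0 * d < d\<close>; x lies in that level, and so do its images under the lambda
  operations.\<close>

lemma dvd_coeff_adams:
  assumes "is_filtered_lambda_ring n d lam" "n \<ge> 2" "d \<ge> 1"
  shows "int k dvd coeff (adams n lam k [:0, 1:]) 1"
proof -
  have "[:0, 1:] \<in> filt n d d"
    using assms by (auto simp: filt_def trunc_carrier_X coeff_pCons split: nat.splits)
  then have "lam i [:0, 1:] \<in> filt n d d" if "i \<ge> 1" for i
    using assms(1) that by (auto simp: is_filtered_lambda_ring_def)
  then have "coeff (lam i [:0, 1:]) 0 = 0" if "i \<ge> 1" for i
    using that assms(3) by (force simp: filt_def)
  from coeff_newt_low(2)[OF this] show ?thesis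
    using assms(2) by (simp add: adams_eq coeff_trunc)
qed

section \<open>Conjugation by a substitution\<close>

definition subst_top :: "nat \<Rightarrow> int \<Rightarrow> int poly \<Rightarrow> int poly" where
  "subst_top n w f = trunc n (f \<circ>\<^sub>p ([:0, 1:] + monom w (n - 1)))"

lemma coeff_top_0: "n \<ge> 2 \<Longrightarrow> coeff ([:0, 1:] + monom w (n - 1)) 0 = 0"
  by simp

lemma pcompose_X: "[:0, 1:] \<circ>\<^sub>p p = (p :: int poly)"
  by (simp add: pcompose_pCons)

lemma subst_top_in_carrier [simp]: "subst_top n w f \<in> trunc_carrier n"
  by (simp add: subst_top_def)

lemma subst_top_add: "subst_top n w (f + g) = subst_top n w f + subst_top n w g"
  by (simp add: subst_top_def pcompose_add trunc_add)

lemma subst_top_tmul: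
  assumes "n \<ge> 2"
  shows "subst_top n w (tmul n f g) = tmul n (subst_top n w f) (subst_top n w g)"
proof -
  let ?c = "[:0, 1:] + monom w (n - 1)"
  have "teq n (trunc n (f * g) \<circ>\<^sub>p ?c) ((f * g) \<circ>\<^sub>p ?c)"
    by (rule teq_pcompose_left[OF teq_trunc coeff_top_0[OF assms]])
  also have "\<dots> = (f \<circ>\<^sub>p ?c) * (g \<circ>\<^sub>p ?c)" by (rule pcompose_mult)
  also have "teq n \<dots> (subst_top n w f * subst_top n w g)"
    unfolding subst_top_def by (intro teq_mult teq_sym[OF teq_trunc])
  finally show ?thesis by (simp only: teq_def tmul_def subst_top_def)
qed

lemma subst_top_one: "n \<ge> 1 \<Longrightarrow> subst_top n w 1 = 1"
  by (simp add: subst_top_def pcompose_1 trunc_carrier_eq trunc_carrier_one)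

text \<open>Perturbations of the identity in the top degree compose by adding their
  coefficients.\<close>

lemma subst_top_inverse:
  assumes "n \<ge> 3" "f \<in> trunc_carrier n"
  shows "subst_top n (- w) (subst_top n w f) = f"
proof -
  let ?c = "\<lambda>w. [:0, 1:] + monom w (n - 1)"
  have "teq n (subst_top n (- w) (subst_top n w f)) ((f \<circ>\<^sub>p ?c w) \<circ>\<^sub>p ?c (- w))"
    unfolding subst_top_def
    by (rule teq_trans[OF teq_trunc], rule teq_pcompose_left[OF teq_trunc coeff_top_0]) (use assms in simp)
  also have "\<dots> = f \<circ>\<^sub>p (?c w \<circ>\<^sub>p ?c (- w))" by (simp add: pcompose_assoc)
  also have "teq n \<dots> (f \<circ>\<^sub>p [:0, 1:])"
  proof (rule teq_pcompose_right)
    have "teq n (?c w \<circ>\<^sub>p ?c (- w)) ([:0, 1:] \<circ>\<^sub>p [:0, 1:] +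
        monom (coeff [:0, 1:] 1 * (- w) + w * coeff [:0, 1:] 1 ^ (n - 1)) (n - 1))"
      by (rule teq_pcompose_perturb) (use assms in auto)
    then show "teq n (?c w \<circ>\<^sub>p ?c (- w)) [:0, 1:]" by (simp add: pcompose_X)
  qed
  also have "\<dots> = f" by (rule pcompose_idR)
  finally show ?thesis by (rule teq_carrier) (use assms in simp_all)
qed

lemma bij_subst_top:
  assumes "n \<ge> 3"
  shows "bij_betw (subst_top n w) (trunc_carrier n) (trunc_carrier n)"
  using subst_top_inverse[OF assms, of _ w] subst_top_inverse[OF assms, of _ "- w"]
  by (intro bij_betw_byWitness[where f' = "subst_top n (- w)"]) auto

lemma subst_top_filt_subset:
  assumes "n \<ge> 2" "f \<in> filt n d k"
  shows "subst_top n w f \<in> filt n d k"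
proof -
  have "k \<le> j * d" if "coeff (subst_top n w f) j \<noteq> 0" for j
  proof -
    let ?c = "[:0, 1:] + monom w (n - 1)"
    have "coeff (f \<circ>\<^sub>p ?c) j \<noteq> 0"
      using that by (auto simp: subst_top_def coeff_trunc split: if_splits)
    then obtain i where i: "i < Suc j" "coeff f i \<noteq> 0"
      using coeff_pcompose_low[OF coeff_top_0[OF assms(1)], of "Suc j" f j w] by blast
    then have "k \<le> i * d" using assms(2) by (auto simp: filt_def)
    also have "\<dots> \<le> j * d" using i by simp
    finally show ?thesis .
  qed
  then show ?thesis by (simp add: filt_def)
qed

lemma subst_top_filt:
  assumes "n \<ge> 3"
  shows "subst_top n w ` filt n d k = filt n d k"
proof
  show "subst_top n w ` filt n d k \<subseteq> filt n d k"
    using subst_top_filt_subset[of n] assms by auto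
  show "filt n d k \<subseteq> subst_top n w ` filt n d k"
  proof
    fix f assume f: "f \<in> filt n d k"
    then have "subst_top n w (subst_top n (- w) f) = f"
      using subst_top_inverse[OF assms, of f "- w"] by (simp add: filt_def)
    moreover have "subst_top n (- w) f \<in> filt n d k"
      using subst_top_filt_subset[of n] assms f by simp
    ultimately show "f \<in> subst_top n w ` filt n d k" by (metis image_eqI)
  qed
qed

text \<open>All maps involved are substitutions, so associativity of composition extends the
  equation for x to every \<open>f\<close>; \<open>adams_adams\<close> extends it from primes to all
  \<open>k >= 1\<close>, and \<open>teq_newtD\<close> transfers it to the lambda operations.\<close>

lemma filt_lambda_isoI:
  assumes n: "n \<ge> 3" and L: "is_lambda_ring n lam" and L': "is_lambda_ring n lam'"
    and eq: "\<And>q. prime q \<Longrightarrow> teq n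
      (([:0, 1:] + monom w (n - 1)) \<circ>\<^sub>p adams n lam' q [:0, 1:])
      (adams n lam q [:0, 1:] \<circ>\<^sub>p ([:0, 1:] + monom w (n - 1)))"
    and F0: "\<And>q. prime q \<Longrightarrow> coeff (adams n lam' q [:0, 1:]) 0 = 0"
  shows "filt_lambda_iso n d lam lam'"
proof -
  let ?c = "[:0, 1:] + monom w (n - 1)"
  let ?\<phi> = "subst_top n w"
  have n2: "n \<ge> 2" using n by simp
  have prime: "adams n lam' q (?\<phi> f) = ?\<phi> (adams n lam q f)"
    if q: "prime q" and f: "f \<in> trunc_carrier n" for q f
  proof -
    let ?F = "adams n lam q [:0, 1:]" and ?F' = "adams n lam' q [:0, 1:]"
    have q1: "q \<ge> 1" using q by (rule prime_ge_1_nat)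
    have "teq n (adams n lam' q (?\<phi> f)) (?\<phi> f \<circ>\<^sub>p ?F')"
      by (rule adams_pcompose'[OF L' n2 q1]) simp
    also have "teq n \<dots> ((f \<circ>\<^sub>p ?c) \<circ>\<^sub>p ?F')"
      unfolding subst_top_def by (rule teq_pcompose_left[OF teq_trunc F0[OF q]])
    also have "\<dots> = f \<circ>\<^sub>p (?c \<circ>\<^sub>p ?F')" by (simp add: pcompose_assoc)
    also have "teq n \<dots> (f \<circ>\<^sub>p (?F \<circ>\<^sub>p ?c))" by (rule teq_pcompose_right[OF eq[OF q]])
    also have "\<dots> = (f \<circ>\<^sub>p ?F) \<circ>\<^sub>p ?c" by (simp add: pcompose_assoc)
    also have "teq n \<dots> (adams n lam q f \<circ>\<^sub>p ?c)"
      by (rule teq_pcompose_left[OF teq_sym[OF adams_pcompose'[OF L n2 q1 f]] coeff_top_0[OF n2]])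
    also have "teq n \<dots> (?\<phi> (adams n lam q f))"
      unfolding subst_top_def by (rule teq_sym[OF teq_trunc])
    finally show ?thesis by (rule teq_carrier) simp_all
  qed
  have all: "adams n lam' k (?\<phi> f) = ?\<phi> (adams n lam k f)"
    if "k \<ge> 1" "f \<in> trunc_carrier n" for k f
    using that
  proof (induction k arbitrary: f rule: prime_divisors_induct)
    case zero
    then show ?case by simp
  next
    case (unit x)
    then show ?case
      using adams_1[OF L n2, of f] adams_1[OF L' n2, of "?\<phi> f"] by simp
  next
    case (factor q k)
    have k: "k \<ge> 1" using factor.prems by (cases k) auto
    have q1: "q \<ge> 1" using factor.hyps by (rule prime_ge_1_nat)
    have "adams n lam' (q * k) (?\<phi> f) = adams n lam' q (adams n lam' k (?\<phi> f))"
      using adams_adams[OF L' n2 q1 k] by simp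
    also have "\<dots> = ?\<phi> (adams n lam q (adams n lam k f))"
      using factor.IH[OF k factor.prems(2)] prime[OF factor.hyps] by simp
    also have "\<dots> = ?\<phi> (adams n lam (q * k) f)"
      using adams_adams[OF L n2 q1 k factor.prems(2)] by simp
    finally show ?case .
  qed
  have lam: "?\<phi> (lam i f) = lam' i (?\<phi> f)" if f: "f \<in> trunc_carrier n" for i f
  proof (cases "i = 0")
    case True
    then show ?thesis using f n lam_0[OF L n2] lam_0[OF L' n2] by (simp add: subst_top_one)
  next
    case False
    have "teq n (newt (\<lambda>i. lam' i (?\<phi> f)) k) (newt (\<lambda>i. lam i f \<circ>\<^sub>p ?c) k)" if k: "k \<ge> 1" for k
    proof -
      have "teq n (newt (\<lambda>i. lam' i (?\<phi> f)) k) (?\<phi> (adams n lam k f))"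
        unfolding all[OF k f, symmetric] adams_eq[of n lam'] by (rule teq_sym[OF teq_trunc])
      also have "teq n \<dots> (newt (\<lambda>i. lam i f) k \<circ>\<^sub>p ?c)"
        unfolding subst_top_def adams_eq
        by (rule teq_trans[OF teq_trunc teq_pcompose_left[OF teq_trunc coeff_top_0[OF n2]]])
      also have "\<dots> = newt (\<lambda>i. lam i f \<circ>\<^sub>p ?c) k" by (rule hom_newt[OF is_hom_pcompose])
      finally show ?thesis .
    qed
    moreover have "i \<ge> 1" using False by simp
    ultimately have "teq n (lam' i (?\<phi> f)) (lam i f \<circ>\<^sub>p ?c)" by (rule teq_newtD)
    also have "teq n \<dots> (?\<phi> (lam i f))" unfolding subst_top_def by (rule teq_sym[OF teq_trunc])
    finally have "lam' i (?\<phi> f) = ?\<phi> (lam i f)"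
      by (rule teq_carrier) (simp_all add: lam_in_carrier[OF L' n2])
    then show ?thesis ..
  qed
  show ?thesis
    unfolding filt_lambda_iso_def
    by (intro exI[of _ ?\<phi>] conjI ballI allI bij_subst_top[OF n] subst_top_add
        subst_top_tmul[OF n2] subst_top_one lam subst_top_filt[OF n]) (use n in auto)
qed

section \<open>Isomorphism classes and their number\<close>

lemma filt_lambda_iso_trans:
  assumes "filt_lambda_iso n d l1 l2" "filt_lambda_iso n d l2 l3"
  shows "filt_lambda_iso n d l1 l3"
proof -
  obtain f where f: "bij_betw f (trunc_carrier n) (trunc_carrier n)"
      "\<forall>a\<in>trunc_carrier n. \<forall>b\<in>trunc_carrier n. f (a + b) = f a + f b"
      "\<forall>a\<in>trunc_carrier n. \<forall>b\<in>trunc_carrier n. f (tmul n a b) = tmul n (f a) (f b)"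
      "f 1 = 1" "\<forall>i. \<forall>a\<in>trunc_carrier n. f (l1 i a) = l2 i (f a)"
      "\<forall>k. f ` filt n d k = filt n d k"
    using assms(1) unfolding filt_lambda_iso_def by blast
  obtain g where g: "bij_betw g (trunc_carrier n) (trunc_carrier n)"
      "\<forall>a\<in>trunc_carrier n. \<forall>b\<in>trunc_carrier n. g (a + b) = g a + g b"
      "\<forall>a\<in>trunc_carrier n. \<forall>b\<in>trunc_carrier n. g (tmul n a b) = tmul n (g a) (g b)"
      "g 1 = 1" "\<forall>i. \<forall>a\<in>trunc_carrier n. g (l2 i a) = l3 i (g a)"
      "\<forall>k. g ` filt n d k = filt n d k"
    using assms(2) unfolding filt_lambda_iso_def by blast
  have fc: "f a \<in> trunc_carrier n" if "a \<in> trunc_carrier n" for a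
    using f(1) that by (auto simp: bij_betw_def)
  show ?thesis
    unfolding filt_lambda_iso_def
  proof (intro exI[of _ "g \<circ> f"] conjI ballI allI)
    show "bij_betw (g \<circ> f) (trunc_carrier n) (trunc_carrier n)"
      using f(1) g(1) by (rule bij_betw_trans)
    show "(g \<circ> f) ` filt n d k = filt n d k" for k
      using f(6) g(6) by (simp only: image_comp[symmetric])
  qed (use f g fc in simp_all)
qed

text \<open>The inverse map undoes \<open>f\<close> only on the carrier, hence the assumption that
  \<open>l1\<close> stays inside it.\<close>

lemma filt_lambda_iso_sym:
  assumes "filt_lambda_iso n d l1 l2" and l1: "\<And>i a. a \<in> trunc_carrier n \<Longrightarrow> l1 i a \<in> trunc_carrier n"
    and n: "n \<ge> 1"
  shows "filt_lambda_iso n d l2 l1"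
proof -
  let ?C = "trunc_carrier n"
  obtain f where f: "bij_betw f ?C ?C"
      "\<forall>a\<in>?C. \<forall>b\<in>?C. f (a + b) = f a + f b"
      "\<forall>a\<in>?C. \<forall>b\<in>?C. f (tmul n a b) = tmul n (f a) (f b)"
      "f 1 = 1" "\<forall>i. \<forall>a\<in>?C. f (l1 i a) = l2 i (f a)"
      "\<forall>k. f ` filt n d k = filt n d k"
    using assms(1) unfolding filt_lambda_iso_def by blast
  let ?g = "inv_into ?C f"
  have inj: "inj_on f ?C" using f(1) by (simp add: bij_betw_def)
  have gf: "?g (f a) = a" if "a \<in> ?C" for a using inj that by simp
  have ex: "\<exists>a\<in>?C. b = f a" if "b \<in> ?C" for b using f(1) that by (auto simp: bij_betw_def)
  show ?thesis
    unfolding filt_lambda_iso_def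
  proof (intro exI[of _ ?g] conjI ballI allI)
    show "bij_betw ?g ?C ?C" by (rule bij_betw_inv_into[OF f(1)])
    show "?g (a + b) = ?g a + ?g b" if ab: "a \<in> ?C" "b \<in> ?C" for a b
    proof -
      obtain a' b' where "a' \<in> ?C" "b' \<in> ?C" "a = f a'" "b = f b'" using ex ab by blast
      then show ?thesis using f(2) gf trunc_carrier_add by metis
    qed
    show "?g (tmul n a b) = tmul n (?g a) (?g b)" if ab: "a \<in> ?C" "b \<in> ?C" for a b
    proof -
      obtain a' b' where "a' \<in> ?C" "b' \<in> ?C" "a = f a'" "b = f b'" using ex ab by blast
      then show ?thesis using f(3) gf tmul_in_carrier by metis
    qed
    show "?g 1 = 1" using gf[of 1] f(4) n by (simp add: trunc_carrier_one)
    show "?g (l2 i a) = l1 i (?g a)" if a: "a \<in> ?C" for i a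
    proof -
      obtain a' where "a' \<in> ?C" "a = f a'" using ex a by blast
      then show ?thesis using f(5) gf l1 by metis
    qed
    show "?g ` filt n d k = filt n d k" for k
    proof -
      have sub: "filt n d k \<subseteq> ?C" by (auto simp: filt_def)
      have "?g ` filt n d k = ?g ` (f ` filt n d k)" using f(6) by simp
      also have "\<dots> = filt n d k" by (rule inv_into_image_cancel[OF inj sub])
      finally show ?thesis .
    qed
  qed
qed

text \<open>Equal values force equivalence, while \<open>f\<close> may vary within a class; so a
  class is recovered by choosing one element for each value. Values not attained give arbitrary
  sets, which is harmless for a covering.\<close>

lemma card_quotient_le:
  assumes "equiv S r" "finite T" "\<And>x. x \<in> S \<Longrightarrow> f x \<in> T"
    and "\<And>x y. x \<in> S \<Longrightarrow> y \<in> S \<Longrightarrow> f x = f y \<Longrightarrow> (x, y) \<in> r"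
  shows "finite (S // r) \<and> card (S // r) \<le> card T"
proof -
  let ?h = "\<lambda>t. r `` {SOME x. x \<in> S \<and> f x = t}"
  have sub: "S // r \<subseteq> ?h ` T"
  proof
    fix X assume "X \<in> S // r"
    then obtain x where x: "x \<in> S" "X = r `` {x}" by (auto elim: quotientE)
    define y where "y = (SOME y. y \<in> S \<and> f y = f x)"
    have "y \<in> S \<and> f y = f x" unfolding y_def by (rule someI[of _ x]) (use x in simp)
    then have "(x, y) \<in> r" using assms(4) x by simp
    then have "X = r `` {y}" unfolding x(2) by (rule equiv_class_eq[OF assms(1)])
    then show "X \<in> ?h ` T" using assms(3)[OF x(1)] unfolding y_def by blast
  qed
  then have "finite (S // r)" using finite_subset assms(2) by blast
  moreover have "card (S // r) \<le> card (?h ` T)" by (rule card_mono) (use sub assms(2) in auto)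
  ultimately show ?thesis using card_image_le[OF assms(2), of ?h] by simp
qed

lemma power_minus_self_neq_0:
  assumes "\<bar>a\<bar> \<ge> (2::int)" "m \<ge> 2"
  shows "a ^ m - a \<noteq> 0"
proof
  assume "a ^ m - a = 0"
  moreover have "a ^ m = a * a ^ (m - 1)" using assms(2) by (simp flip: power_Suc)
  ultimately have "a * (a ^ (m - 1) - 1) = 0" by (simp add: algebra_simps)
  then have "a ^ (m - 1) = 1" using assms(1) by auto
  moreover have "\<bar>a\<bar> ^ 1 \<le> \<bar>a\<bar> ^ (m - 1)" by (rule power_increasing) (use assms in auto)
  ultimately show False using assms(1) by (simp flip: power_abs)
qed

theorem theorem1p8:
  fixes n d :: nat and a :: "nat \<Rightarrow> nat \<Rightarrow> int"
  assumes "n \<ge> 3" and "d \<ge> 1"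
    and "\<And>p. prime p \<Longrightarrow> a p 1 \<noteq> 0"
  defines "S \<equiv> {lam. is_filtered_lambda_ring n d lam \<and>
              (\<forall>p. prime p \<longrightarrow> (\<forall>j < n - 1.
                 coeff (adams n lam p [:0, 1:]) j = (if 1 \<le> j then a p j else 0)))}"
  shows "finite (S // {(lam, lam'). lam \<in> S \<and> lam' \<in> S \<and> filt_lambda_iso n d lam lam'})
    \<and> (\<forall>p. prime p \<longrightarrow>
         card (S // {(lam, lam'). lam \<in> S \<and> lam' \<in> S \<and> filt_lambda_iso n d lam lam'})
           \<le> nat \<bar>a p 1 ^ (n - 1) - a p 1\<bar>)"
proof -
  let ?r = "{(lam, lam'). lam \<in> S \<and> lam' \<in> S \<and> filt_lambda_iso n d lam lam'}"
  have n2: "n \<ge> 2" using assms(1) by simp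
  define F where "F lam q = adams n lam q [:0, 1:]" for lam q
  define M where "M q = a q 1 ^ (n - 1) - a q 1" for q
  \<comment> \<open>The prescription fixes every coefficient below \<open>n - 1\<close>, so this is
    the only freedom left.\<close>
  define top where "top lam q = coeff (F lam q) (n - 1)" for lam q
  have S: "is_lambda_ring n lam" if "lam \<in> S" for lam
    using that by (simp add: S_def is_filtered_lambda_ring_def)
  \<comment> \<open>Index 1 lies in the prescribed range because \<open>n >= 3\<close>.\<close>
  have F0: "coeff (F lam q) 0 = 0" and F1: "coeff (F lam q) 1 = a q 1" if "lam \<in> S" "prime q" for lam q
    using that assms(1) by (auto simp: S_def F_def)
  \<comment> \<open>Divisibility of \<open>a q 1\<close> by \<open>q\<close> is read off from an
    existing structure, so an element of \<open>S\<close> is required.\<close>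
  have M0: "M q \<noteq> 0" if lam: "lam \<in> S" and q: "prime q" for lam q
  proof -
    have "int q dvd a q 1"
      using dvd_coeff_adams[of n d lam q] lam n2 assms(2) F1[OF lam q] by (simp add: S_def F_def)
    then have "\<bar>int q\<bar> \<le> \<bar>a q 1\<bar>" using assms(3)[OF q] by (rule dvd_imp_le_int[rotated])
    then have "\<bar>a q 1\<bar> \<ge> 2" using prime_ge_2_nat[OF q] by linarith
    then show ?thesis unfolding M_def by (rule power_minus_self_neq_0) (use assms(1) in simp)
  qed
  have iso: "filt_lambda_iso n d lam lam'"
    if lam: "lam \<in> S" and lam': "lam' \<in> S" and p: "prime p" and dvd: "M p dvd top lam' p - top lam p"
    for lam lam' p
  proof -
    define \<beta> where "\<beta> q = top lam' q - top lam q" for q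
    have F': "F lam' q = F lam q + monom (\<beta> q) (n - 1)" if q: "prime q" for q
    proof (rule poly_eqI)
      fix j
      consider "j < n - 1" | "j = n - 1" | "j \<ge> n" "j \<noteq> n - 1" using assms(1) by linarith
      then show "coeff (F lam' q) j = coeff (F lam q + monom (\<beta> q) (n - 1)) j"
      proof cases
        case 1
        then show ?thesis using lam lam' q by (simp add: S_def F_def)
      next
        case 2
        then show ?thesis by (simp add: \<beta>_def top_def)
      next
        case 3
        then have "coeff (F l q) j = 0" for l
          using adams_in_carrier[of n l q "[:0, 1:]"] by (simp add: F_def trunc_carrier_def)
        then show ?thesis using 3 by simp
      qed
    qed
    have commute: "teq n (F l q \<circ>\<^sub>p F l r) (F l r \<circ>\<^sub>p F l q)"
      if "l \<in> S" "prime q" "prime r" for l q r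
    proof -
      have ge: "q \<ge> 1" "r \<ge> 1" using that prime_ge_1_nat by blast+
      \<comment> \<open>Applying psi^r substitutes \<open>F l r\<close>, so it acts on
        \<open>F l q\<close> by composition from the right.\<close>
      have comp: "teq n (F l q \<circ>\<^sub>p F l r) (adams n l (r * q) [:0, 1:])" if ge: "q \<ge> 1" "r \<ge> 1" for q r
      proof -
        have "teq n (F l q \<circ>\<^sub>p F l r) (adams n l r (F l q))"
          unfolding F_def by (rule teq_sym[OF adams_pcompose'[OF S[OF \<open>l \<in> S\<close>] n2 ge(2)]]) simp
        then show ?thesis
          unfolding F_def by (simp add: adams_adams[OF S[OF \<open>l \<in> S\<close>] n2 ge(2,1) trunc_carrier_X[OF n2]])
      qed
      show ?thesis
        using teq_trans[OF comp[OF ge] teq_sym[OF comp[OF ge(2,1), unfolded mult.commute[of q r]]]] .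
    qed
    \<comment> \<open>In degree \<open>n - 1\<close> the commutation relation of \<open>lam'\<close>
      differs from that of \<open>lam\<close> by the two perturbation terms, which must therefore
      agree.\<close>
    have rel: "\<beta> q * M p = \<beta> p * M q" if q: "prime q" for q
    proof -
      have pert: "teq n (F lam' q \<circ>\<^sub>p F lam' r)
          (F lam q \<circ>\<^sub>p F lam r + monom (a q 1 * \<beta> r + \<beta> q * a r 1 ^ (n - 1)) (n - 1))"
        if q: "prime q" and r: "prime r" for q r
        using teq_pcompose_perturb[OF assms(1) F0[OF lam r], of "F lam q" "\<beta> q" "\<beta> r"]
        unfolding F'[OF q] F'[OF r] F1[OF lam q] F1[OF lam r] .
      have "teq n (F lam q \<circ>\<^sub>p F lam p + monom (a q 1 * \<beta> p + \<beta> q * a p 1 ^ (n - 1)) (n - 1))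
          (F lam p \<circ>\<^sub>p F lam q + monom (a p 1 * \<beta> q + \<beta> p * a q 1 ^ (n - 1)) (n - 1))"
        using teq_trans[OF teq_sym[OF pert[OF q p]] teq_trans[OF commute[OF lam' q p] pert[OF p q]]] .
      then have "coeff (F lam q \<circ>\<^sub>p F lam p) (n - 1) + (a q 1 * \<beta> p + \<beta> q * a p 1 ^ (n - 1)) =
          coeff (F lam p \<circ>\<^sub>p F lam q) (n - 1) + (a p 1 * \<beta> q + \<beta> p * a q 1 ^ (n - 1))"
        using assms(1) unfolding teq_iff by (auto dest!: spec[of _ "n - 1"])
      moreover have "coeff (F lam q \<circ>\<^sub>p F lam p) (n - 1) = coeff (F lam p \<circ>\<^sub>p F lam q) (n - 1)"
        using commute[OF lam q p] assms(1) unfolding teq_iff by simp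
      ultimately show ?thesis by (simp add: M_def algebra_simps)
    qed
    obtain u where u: "\<beta> p = M p * u" using dvd unfolding \<beta>_def by (elim dvdE)
    have \<beta>: "\<beta> q = M q * u" if "prime q" for q
    proof -
      have "M p * \<beta> q = M p * (M q * u)" using rel[OF that] u by (simp add: mult_ac)
      then show ?thesis using M0[OF lam p] by simp
    qed
    show ?thesis
    \<comment> \<open>In degree \<open>n - 1\<close> the intertwining equation reads \<beta>_q + w
      a_q^(n-1) = w a_q, that is \<beta>_q = -w \<open>M q\<close>; hence the sign of
      \<open>w\<close>.\<close>
    proof (rule filt_lambda_isoI[OF assms(1) S[OF lam] S[OF lam'], where w = "- u"])
      fix q :: nat assume q: "prime q"
      show "coeff (adams n lam' q [:0, 1:]) 0 = 0" using F0[OF lam' q] by (simp add: F_def)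
      let ?c = "[:0, 1:] + monom (- u) (n - 1)"
      have "teq n (?c \<circ>\<^sub>p F lam' q) ([:0, 1:] \<circ>\<^sub>p F lam q +
          monom (coeff [:0, 1:] 1 * \<beta> q + (- u) * coeff (F lam q) 1 ^ (n - 1)) (n - 1))"
        unfolding F'[OF q] by (rule teq_pcompose_perturb[OF assms(1) F0[OF lam q]])
      also have "\<dots> = F lam q + monom (- u * a q 1) (n - 1)"
        by (simp add: pcompose_X F1[OF lam q, simplified] \<beta>[OF q] M_def algebra_simps)
      finally have 1: "teq n (?c \<circ>\<^sub>p F lam' q) (F lam q + monom (- u * a q 1) (n - 1))" .
      \<comment> \<open>The zero monomial brings the unperturbed outer polynomial into the shape of
        the expansion lemma.\<close>
      have "teq n ((F lam q + monom 0 (n - 1)) \<circ>\<^sub>p ?c) (F lam q \<circ>\<^sub>p [:0, 1:] +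
          monom (coeff (F lam q) 1 * (- u) + 0 * coeff [:0, 1:] 1 ^ (n - 1)) (n - 1))"
        by (rule teq_pcompose_perturb[OF assms(1)]) simp
      then have "teq n (F lam q \<circ>\<^sub>p ?c) (F lam q + monom (- u * a q 1) (n - 1))"
        by (simp add: F1[OF lam q, simplified] pcompose_idR mult.commute)
      then show "teq n (?c \<circ>\<^sub>p adams n lam' q [:0, 1:]) (adams n lam q [:0, 1:] \<circ>\<^sub>p ?c)"
        using 1 unfolding F_def by (blast intro: teq_trans teq_sym)
    qed
  qed
  have equiv: "equiv S ?r"
  proof (rule equivI)
    \<comment> \<open>Reflexivity is the case \<open>lam' = lam\<close> of \<open>iso\<close>, where
      the difference 0 is divisible by \<open>M 2\<close>.\<close>
    show "refl_on S ?r" using iso[OF _ _ two_is_prime_nat] by (auto simp: refl_on_def)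
    show "sym ?r"
      using filt_lambda_iso_sym[of n d] lam_in_carrier[OF S n2] assms(1) by (auto simp: sym_def)
    show "trans ?r" by (auto simp: trans_def intro: filt_lambda_iso_trans)
  qed auto
  have bound: "finite (S // ?r) \<and> card (S // ?r) \<le> nat \<bar>M p\<bar>" if p: "prime p" for p
  \<comment> \<open>Without a structure \<open>M p\<close> might be 0, but then the quotient is
    empty.\<close>
  proof (cases "S = {}")
    case False
    then have "M p \<noteq> 0" using M0 p by blast
    then have pos: "\<bar>M p\<bar> > 0" by simp
    have "finite (S // ?r) \<and> card (S // ?r) \<le> card {0..<\<bar>M p\<bar>}"
    \<comment> \<open>Residues are taken modulo the absolute value so that they lie in an interval
      of exactly that many integers, whatever the sign of \<open>M p\<close>.\<close>
    proof (rule card_quotient_le[OF equiv, where f = "\<lambda>lam. top lam p mod \<bar>M p\<bar>"])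
      fix x y assume xy: "x \<in> S" "y \<in> S" "top x p mod \<bar>M p\<bar> = top y p mod \<bar>M p\<bar>"
      then have "\<bar>M p\<bar> dvd top y p - top x p" 
        by (metis mod_eq_dvd_iff)
      then show "(x, y) \<in> ?r" using iso[OF xy(1,2) p] xy by simp
    qed (use pos in auto)
    then show ?thesis by simp
  qed simp
  show ?thesis using bound two_is_prime_nat unfolding M_def by blast
qed

end
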